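(* For every even integer $d \ge 4$ there exists a constant $c(d)>0$, depending only on $d$, such that for every Salem number $\beta$ of degree $d$, $$ \liminf_{M\to \infty} \frac {\mathrm{Card}\left\{ m\in [1,M]\cap \mathbb Z\ \middle|\ d_{\beta^m}(1) \text{ is $(1,p)$-periodic for some } p\in \mathbb N \right\}}{M}\ge c(d). $$ In particular, there are infinitely many positive integers $m$ such that $\beta^m$ is a Parry number.
   Context: A Salem number is an algebraic integer $\beta>1$ all of whose Galois conjugates have modulus at most $1$, with at least one conjugate of modulus exactly $1$ (its degree is necessarily even and at least $4$). For a real $\beta>1$, the beta transformation is $T_\beta(x)=\beta x-\lfloor \beta x\rfloor$ on $[0,1)$; for $x\in[0,1)$ put $x_n=\lfloor \beta T_\beta^{n-1}(x)\rfloor$ and $d_\beta(x)=x_1x_2x_3\cdots$ (the greedy $\beta$-expansion, $x=\sum_n x_n\beta^{-n}$). The expansion of one is the infinite word $d_\beta(1):=\lim_{\epsilon\downarrow 0} d_\beta(1-\epsilon)$ (limit in the product topology). An infinite word $x_1x_2\cdots$ is eventually periodic if it can be written $x_1\cdots x_m(x_{m+1}\cdots x_{m+p})^\infty$ with $m\ge 0$, $p\ge 1$; choosing $m$ and $p$ minimal, the word is called $(m,p)$-periodic. $\beta$ is a Parry number if $d_\beta(1)$ is eventually periodic. *)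

theory Defs
  imports "HOL-Analysis.Analysis" "HOL-Computational_Algebra.Polynomial" "HOL-Library.Extended_Real"
begin

definition salem_number :: "real \<Rightarrow> nat \<Rightarrow> bool" where
  "salem_number \<beta> d \<longleftrightarrow> \<beta> > 1 \<and>
     (\<exists>p :: int poly. lead_coeff p = 1 \<and> irreducible p \<and> degree p = d \<and>
        poly (map_poly of_int p) \<beta> = (0::real) \<and>
        (\<forall>z::complex. poly (map_poly of_int p) z = 0 \<and> z \<noteq> complex_of_real \<beta> \<longrightarrow> cmod z \<le> 1) \<and>
        (\<exists>z::complex. poly (map_poly of_int p) z = 0 \<and> cmod z = 1))"

definition beta_trans :: "real \<Rightarrow> real \<Rightarrow> real" where
  "beta_trans \<beta> x = \<beta> * x - of_int \<lfloor>\<beta> * x\<rfloor>"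

(* greedy digits, 0-based: beta_digits beta x n = x_{n+1} = floor(beta * T^n x) *)
definition beta_digits :: "real \<Rightarrow> real \<Rightarrow> nat \<Rightarrow> nat" where
  "beta_digits \<beta> x n = nat \<lfloor>\<beta> * (beta_trans \<beta> ^^ n) x\<rfloor>"

(* d_beta(1) = limit of d_beta(1 - eps) as eps decreases to 0, in the product topology
   on infinite words (nat => nat with the product topology of discrete nat) *)
definition expansion_one :: "real \<Rightarrow> nat \<Rightarrow> nat" where
  "expansion_one \<beta> = (THE w. ((\<lambda>\<epsilon>. beta_digits \<beta> (1 - \<epsilon>)) \<longlongrightarrow> w) (at_right 0))"

(* w (0-based) is of the form x_1..x_m (x_{m+1}..x_{m+p})^infinity *)
definition periodic_from :: "(nat \<Rightarrow> nat) \<Rightarrow> nat \<Rightarrow> nat \<Rightarrow> bool" where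
  "periodic_from w m p \<longleftrightarrow> p \<ge> 1 \<and> (\<forall>n\<ge>m. w (n + p) = w n)"

definition eventually_periodic :: "(nat \<Rightarrow> nat) \<Rightarrow> bool" where
  "eventually_periodic w \<longleftrightarrow> (\<exists>m p. periodic_from w m p)"

definition mp_periodic :: "(nat \<Rightarrow> nat) \<Rightarrow> nat \<Rightarrow> nat \<Rightarrow> bool" where
  "mp_periodic w m p \<longleftrightarrow> periodic_from w m p \<and>
     (\<forall>m' p'. periodic_from w m' p' \<longrightarrow> m \<le> m') \<and>
     (\<forall>p'. periodic_from w m p' \<longrightarrow> p \<le> p')"

definition parry_number :: "real \<Rightarrow> bool" where
  "parry_number \<beta> \<longleftrightarrow> eventually_periodic (expansion_one \<beta>)"

end

theory Submission
  imports Defs "Jordan_Normal_Form.Char_Poly"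
begin

text \<open>
  Let \<open>\<beta>\<close> be a Salem number of degree \<open>d = 2 * k + 2\<close> with unimodular conjugates \<open>cis (\<plusminus> 2 \<pi> \<theta>\<^sub>j)\<close>,
  \<open>j < k\<close>. The polynomial with roots the \<open>m\<close>-th powers of the conjugates of \<open>\<beta>\<close> is
  \<open>(x\<^sup>2 - s x + 1) R(x)\<close> with \<open>s = \<beta> ^ m + \<beta> ^ (- m)\<close> and \<open>R = \<Prod>j. (x\<^sup>2 - 2 cos (2 \<pi> m \<theta>\<^sub>j) x + 1)\<close>.
  For large \<open>s\<close> its negated middle coefficients are dominated by \<open>s\<close> times the coefficients of \<open>R\<close>. So if
  the middle coefficients of \<open>R\<close> lie strictly between 0 and 1, the polynomial can be read as a
  Parry polynomial, whose word has preperiod 1 and a first letter larger than all others. Such \<open>R\<close> exist,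
  and form an open condition on \<open>(m \<theta>\<^sub>j)\<^sub>j\<close> modulo 1. Since the \<open>\<theta>\<^sub>j\<close> and 1 are linearly independent over the
  integers, it holds for a set of \<open>m\<close> whose lower density is bounded below in terms of \<open>k\<close> only.
\<close>

hide_const (open) Module.smult

section \<open>Conjugation homomorphisms between subfields\<close>

text \<open>The interval (0, 1) comes from the shape of the letters. Up to a bounded error the
  letter belonging to a middle coefficient r of R is s * r, while the first letter is s minus the
  linear coefficient of R. So r > 0 keeps a letter positive, r < 1 keeps it below the first one, and
  a linear coefficient above 1 / \<open>\<beta>\<close> ^ m keeps the first letter at most
  \<open>\<beta>\<close> ^ m. The simplest unimodular candidate x ^ (2k) + 1 lies on the boundary,
  with middle coefficients 0. Raising each of the 2k - 1 middle coefficients to 1 / (2k) is a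
  perturbation of total size below 1, which preserves the sign changes that locate the roots on the
  circle. Both arithmetic inputs, independence of the angles and distinctness of the m-th powers of
  the conjugates, come from moving a chosen conjugate to \<open>\<beta>\<close>, the only one
  outside the closed unit disc. This needs embeddings of a field containing all conjugates,
  constructed below inside the complex numbers.\<close>

definition is_subfield :: "'a::field set \<Rightarrow> bool" where
  "is_subfield K \<longleftrightarrow> 1 \<in> K \<and> (\<forall>x\<in>K. \<forall>y\<in>K. x - y \<in> K \<and> x * y \<in> K) \<and> (\<forall>x\<in>K. inverse x \<in> K)"

text \<open>\<open>\<tau>\<close> is a total function constrained only on \<open>K\<close>, so
  extending it to a larger field means agreeing on \<open>K\<close>. Compatibility with 0,
  differences and inverses follows.\<close>

definition field_hom_on :: "'a::field set \<Rightarrow> ('a \<Rightarrow> 'b::field) \<Rightarrow> bool" where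
  "field_hom_on K \<tau> \<longleftrightarrow> \<tau> 1 = 1 \<and> (\<forall>x\<in>K. \<forall>y\<in>K. \<tau> (x + y) = \<tau> x + \<tau> y \<and> \<tau> (x * y) = \<tau> x * \<tau> y)"

definition polys_over :: "'a::zero set \<Rightarrow> 'a poly set" where
  "polys_over K = {p. \<forall>i. coeff p i \<in> K}"

lemma subfield_closed:
  assumes "is_subfield K"
  shows "1 \<in> K" "0 \<in> K" "x \<in> K \<Longrightarrow> - x \<in> K" "x \<in> K \<Longrightarrow> y \<in> K \<Longrightarrow> x + y \<in> K"
    "x \<in> K \<Longrightarrow> y \<in> K \<Longrightarrow> x - y \<in> K" "x \<in> K \<Longrightarrow> y \<in> K \<Longrightarrow> x * y \<in> K" "x \<in> K \<Longrightarrow> inverse x \<in> K"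
proof -
  show 1: "1 \<in> K" and d: "x \<in> K \<Longrightarrow> y \<in> K \<Longrightarrow> x - y \<in> K" and "x \<in> K \<Longrightarrow> y \<in> K \<Longrightarrow> x * y \<in> K"
    "x \<in> K \<Longrightarrow> inverse x \<in> K" for x y
    using assms unfolding is_subfield_def by blast+
  show 0: "0 \<in> K" using d[OF 1 1] by simp
  show m: "x \<in> K \<Longrightarrow> - x \<in> K" for x using d[OF 0, of x] by simp
  show "x \<in> K \<Longrightarrow> y \<in> K \<Longrightarrow> x + y \<in> K" using d[of x "- y"] m[of y] by simp
qed

lemma subfield_sum: "is_subfield K \<Longrightarrow> (\<And>i. i \<in> A \<Longrightarrow> f i \<in> K) \<Longrightarrow> sum f A \<in> K"
  by (induction A rule: infinite_finite_induct) (auto simp: subfield_closed)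

lemma subfield_prod: "is_subfield K \<Longrightarrow> (\<And>i. i \<in> A \<Longrightarrow> f i \<in> K) \<Longrightarrow> prod f A \<in> K"
  by (induction A rule: infinite_finite_induct) (auto simp: subfield_closed)

lemma subfield_power: "is_subfield K \<Longrightarrow> x \<in> K \<Longrightarrow> x ^ n \<in> K"
  by (induction n) (auto simp: subfield_closed)

lemma polys_over_closed:
  assumes "is_subfield K"
  shows "p \<in> polys_over K \<Longrightarrow> q \<in> polys_over K \<Longrightarrow> p + q \<in> polys_over K"
    "p \<in> polys_over K \<Longrightarrow> q \<in> polys_over K \<Longrightarrow> p - q \<in> polys_over K"
    "p \<in> polys_over K \<Longrightarrow> q \<in> polys_over K \<Longrightarrow> p * q \<in> polys_over K"
    "c \<in> K \<Longrightarrow> p \<in> polys_over K \<Longrightarrow> smult c p \<in> polys_over K"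
    "c \<in> K \<Longrightarrow> p \<in> polys_over K \<Longrightarrow> pCons c p \<in> polys_over K"
    "c \<in> K \<Longrightarrow> monom c n \<in> polys_over K"
    "0 \<in> polys_over K"
  unfolding polys_over_def using assms
  by (auto simp: subfield_closed coeff_mult coeff_pCons split: nat.split intro!: subfield_sum)

text \<open>Long division in the ambient field never leaves \<open>K\<close>: the only element
  inverted is the leading coefficient of \<open>g\<close>.\<close>

lemma polys_over_division:
  assumes K: "is_subfield K" and g: "g \<in> polys_over K" "g \<noteq> 0" and f: "f \<in> polys_over K"
  shows "\<exists>q\<in>polys_over K. \<exists>r\<in>polys_over K. f = g * q + r \<and> (r = 0 \<or> degree r < degree g)"
  using f
proof (induction "degree f" arbitrary: f rule: less_induct)
  case less
  show ?case
  proof (cases "f = 0 \<or> degree f < degree g")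
    case True
    then show ?thesis
      using less.prems polys_over_closed(7)[OF K] by (intro bexI[of _ 0] bexI[of _ f]) auto
  next
    case False
    define c where "c = lead_coeff f * inverse (lead_coeff g)"
    define u where "u = monom c (degree f - degree g)"
    have lc: "lead_coeff f \<in> K" "lead_coeff g \<in> K"
      using less.prems g by (auto simp: polys_over_def)
    have u: "u \<in> polys_over K"
      unfolding u_def c_def using K lc by (intro polys_over_closed subfield_closed)
    define h where "h = f - g * u"
    have h: "h \<in> polys_over K"
      unfolding h_def using K u less.prems g by (intro polys_over_closed)
    have c0: "c \<noteq> 0" unfolding c_def using False g by auto
    have dgu: "degree (g * u) = degree f"
      unfolding u_def using c0 False g by (simp add: degree_mult_eq monom_eq_0_iff degree_monom_eq)
    have "lead_coeff (g * u) = lead_coeff f"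
      unfolding lead_coeff_mult using c0 g by (simp add: u_def degree_monom_eq c_def)
    hence "coeff h (degree f) = 0" by (simp add: h_def dgu)
    moreover have "degree h \<le> degree f" unfolding h_def using dgu by (intro degree_diff_le) auto
    ultimately have "h = 0 \<or> degree h < degree f"
      by (metis le_neq_implies_less leading_coeff_0_iff)
    thus ?thesis
    proof
      assume "h = 0"
      thus ?thesis using u polys_over_closed(7)[OF K] by (intro bexI[of _ u] bexI[of _ 0]) (auto simp: h_def)
    next
      assume "degree h < degree f"
      from less.hyps[OF this h] obtain q r where
        qr: "q \<in> polys_over K" "r \<in> polys_over K" "h = g * q + r" "r = 0 \<or> degree r < degree g" by blast
      hence "f = g * (u + q) + r" by (simp add: h_def algebra_simps)
      thus ?thesis using qr polys_over_closed(1)[OF K u qr(1)] by blast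
    qed
  qed
qed

lemma field_hom_onD:
  assumes "is_subfield K" "field_hom_on K \<tau>"
  shows "\<tau> 1 = 1" "\<tau> 0 = 0" "x \<in> K \<Longrightarrow> y \<in> K \<Longrightarrow> \<tau> (x + y) = \<tau> x + \<tau> y"
    "x \<in> K \<Longrightarrow> y \<in> K \<Longrightarrow> \<tau> (x * y) = \<tau> x * \<tau> y"
    "x \<in> K \<Longrightarrow> y \<in> K \<Longrightarrow> \<tau> (x - y) = \<tau> x - \<tau> y"
    "x \<in> K \<Longrightarrow> \<tau> (inverse x) = inverse (\<tau> x)"
    "x \<in> K \<Longrightarrow> \<tau> x = 0 \<longleftrightarrow> x = 0"
proof -
  show 1: "\<tau> 1 = 1" and a: "x \<in> K \<Longrightarrow> y \<in> K \<Longrightarrow> \<tau> (x + y) = \<tau> x + \<tau> y"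
    and m: "x \<in> K \<Longrightarrow> y \<in> K \<Longrightarrow> \<tau> (x * y) = \<tau> x * \<tau> y" for x y
    using assms unfolding field_hom_on_def by blast+
  have "\<tau> 0 + 0 = \<tau> 0 + \<tau> 0" using a[of 0 0] subfield_closed(2)[OF assms(1)] by (simp only: add_0_right)
  thus 0: "\<tau> 0 = 0" by (simp only: add_left_cancel)
  show "\<tau> (x - y) = \<tau> x - \<tau> y" if "x \<in> K" "y \<in> K"
    using a[of "x - y" y] that subfield_closed(5)[OF assms(1) that] by simp
  have i: "\<tau> x * \<tau> (inverse x) = 1" if "x \<in> K" "x \<noteq> 0" for x
    using m[of x "inverse x"] that 1 subfield_closed(7)[OF assms(1)] by simp
  show "\<tau> (inverse x) = inverse (\<tau> x)" if "x \<in> K"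
    using i[OF that] 0 by (cases "x = 0") (auto simp: inverse_unique)
  show "\<tau> x = 0 \<longleftrightarrow> x = 0" if "x \<in> K" using i[OF that] 0 by fastforce
qed

lemma field_hom_on_sum:
  assumes "is_subfield K" "field_hom_on K \<tau>" "\<And>i. i \<in> A \<Longrightarrow> f i \<in> K"
  shows "\<tau> (sum f A) = (\<Sum>i\<in>A. \<tau> (f i))"
  using assms(3)
  by (induction A rule: infinite_finite_induct)
    (auto simp: field_hom_onD[OF assms(1,2)] subfield_sum[OF assms(1)])

lemma field_hom_on_prod:
  assumes "is_subfield K" "field_hom_on K \<tau>" "\<And>i. i \<in> A \<Longrightarrow> f i \<in> K"
  shows "\<tau> (prod f A) = (\<Prod>i\<in>A. \<tau> (f i))"
  using assms(3)
  by (induction A rule: infinite_finite_induct)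
    (auto simp: field_hom_onD[OF assms(1,2)] subfield_prod[OF assms(1)])

lemma field_hom_on_power:
  assumes "is_subfield K" "field_hom_on K \<tau>" "x \<in> K"
  shows "\<tau> (x ^ n) = \<tau> x ^ n"
  by (induction n) (auto simp: field_hom_onD[OF assms(1,2)] subfield_power assms)

lemma field_hom_on_power_int:
  assumes "is_subfield K" "field_hom_on K \<tau>" "x \<in> K"
  shows "\<tau> (x powi n) = \<tau> x powi n"
  unfolding power_int_def
  by (auto simp: field_hom_on_power[OF assms(1,2)] assms subfield_closed(7)[OF assms(1,3)]
      field_hom_onD[OF assms(1,2)])

lemma subfield_power_int: "is_subfield K \<Longrightarrow> x \<in> K \<Longrightarrow> x powi n \<in> K"
  unfolding power_int_def by (auto simp: subfield_power subfield_closed)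

lemma field_hom_on_inj:
  assumes "is_subfield K" "field_hom_on K \<tau>" "x \<in> K" "y \<in> K" "\<tau> x = \<tau> y"
  shows "x = y"
  using field_hom_onD(5)[OF assms(1-4)] field_hom_onD(7)[OF assms(1,2), of "x - y"]
    subfield_closed(5)[OF assms(1,3,4)] assms(5) by simp

lemma map_poly_hom_on:
  assumes K: "is_subfield K" "field_hom_on K \<tau>"
    and p: "p \<in> polys_over K" and q: "q \<in> polys_over K"
  shows "map_poly \<tau> (p + q) = map_poly \<tau> p + map_poly \<tau> q"
    and "map_poly \<tau> (p - q) = map_poly \<tau> p - map_poly \<tau> q"
    and "map_poly \<tau> (p * q) = map_poly \<tau> p * map_poly \<tau> q"
    and "a \<in> K \<Longrightarrow> \<tau> (poly p a) = poly (map_poly \<tau> p) (\<tau> a)"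
proof -
  note h = field_hom_onD[OF K]
  have c: "coeff p i \<in> K" "coeff q i \<in> K" for i using p q by (auto simp: polys_over_def)
  note cm = coeff_map_poly[of \<tau>, OF h(2)]
  show "map_poly \<tau> (p + q) = map_poly \<tau> p + map_poly \<tau> q"
    "map_poly \<tau> (p - q) = map_poly \<tau> p - map_poly \<tau> q"
    by (auto intro!: poly_eqI simp: cm h c)
  show "map_poly \<tau> (p * q) = map_poly \<tau> p * map_poly \<tau> q"
    by (rule poly_eqI) (simp add: cm coeff_mult field_hom_on_sum[OF K] h c subfield_closed[OF K(1)])
  have "poly (map_poly \<tau> p) x = (\<Sum>i\<le>degree p. \<tau> (coeff p i) * x ^ i)" for x
    unfolding poly_altdef cm
    by (rule sum.mono_neutral_left) (auto simp: map_poly_degree_leq not_le coeff_eq_0 h cm[symmetric])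
  thus "\<tau> (poly p a) = poly (map_poly \<tau> p) (\<tau> a)" if "a \<in> K"
    using that unfolding poly_altdef
    by (simp add: field_hom_on_sum[OF K] h c subfield_closed[OF K(1)] subfield_power[OF K(1)]
        field_hom_on_power[OF K])
qed

text \<open>Inverses in \<open>K[a]\<close> come from a Euclidean descent. Dividing \<open>m\<close>
  by a \<open>p\<close> of smaller positive degree leaves a remainder that is nonzero at
  \<open>a\<close>, so the degree drops until a nonzero constant is reached; a \<open>p\<close> of
  larger degree is first reduced modulo \<open>m\<close>.\<close>

lemma subfield_simple_extension:
  assumes K: "is_subfield K" and m: "m \<in> polys_over K" "m \<noteq> 0" "poly m a = 0"
    and min: "\<forall>p\<in>polys_over K. p \<noteq> 0 \<longrightarrow> poly p a = 0 \<longrightarrow> degree m \<le> degree p"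
  shows "is_subfield ((\<lambda>p. poly p a) ` polys_over K)"
proof -
  let ?K = "(\<lambda>p. poly p a) ` polys_over K"
  note cl = polys_over_closed[OF K]
  have inv: "\<exists>q\<in>polys_over K. poly p a * poly q a = 1"
    if "p \<in> polys_over K" "poly p a \<noteq> 0" for p
    using that
  proof (induction "degree p" arbitrary: p rule: less_induct)
    case less
    show ?case
    proof (cases "degree p = 0")
      case True
      then obtain c where c: "p = [:c:]" by (metis degree_eq_zeroE)
      moreover have "coeff p 0 \<in> K" using less.prems by (auto simp: polys_over_def)
      ultimately have "c \<in> K" "c \<noteq> 0" using less.prems by auto
      thus ?thesis
        using subfield_closed(7)[OF K] cl by (intro bexI[of _ "[:inverse c:]"]) (auto simp: c)
    next
      case False
      have p0: "p \<noteq> 0" using less.prems by auto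
      show ?thesis
      proof (cases "degree p < degree m")
        case True
        obtain u r where ur: "u \<in> polys_over K" "r \<in> polys_over K" "m = p * u + r"
          "r = 0 \<or> degree r < degree p"
          using polys_over_division[OF K less.prems(1) p0 m(1)] by blast
        have e: "poly p a * poly u a = - poly r a"
          using m(3) unfolding ur(3) by (simp add: add_eq_0_iff2)
        show ?thesis
        proof (cases "poly r a = 0")
          \<comment> \<open>A remainder vanishing at \<open>a\<close> is 0 by minimality, so
            \<open>m = p * u\<close> with \<open>u\<close> vanishing at \<open>a\<close>; minimality
            applied to \<open>u\<close> then forces \<open>p\<close> to be constant.\<close>
          case True2: True
          have r0: "r = 0" using min[rule_format, OF ur(2) _ True2] ur(4) True by linarith
          have "poly u a = 0" using e True2 less.prems by simp
          moreover have "u \<noteq> 0" using ur(3) r0 m(2) by auto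
          ultimately have "degree m \<le> degree u" using min ur(1) by (simp)
          moreover have "degree m = degree p + degree u"
            using ur(3) r0 p0 \<open>u \<noteq> 0\<close> by (simp add: degree_mult_eq)
          ultimately show ?thesis using False by simp
        next
          case False2: False
          hence "degree r < degree p" using ur(4) by auto
          from less.hyps[OF this ur(2) False2] obtain q where
            q: "q \<in> polys_over K" "poly r a * poly q a = 1" by blast
          have "poly p a * poly (0 - u * q) a = 1" using e q(2) by (simp add: mult.assoc[symmetric])
          moreover have "0 - u * q \<in> polys_over K" using cl ur q by blast
          ultimately show ?thesis by blast
        qed
      next
        case ge: False
        obtain u r where ur: "u \<in> polys_over K" "r \<in> polys_over K" "p = m * u + r"
          "r = 0 \<or> degree r < degree m"
          using polys_over_division[OF K m(1,2) less.prems(1)] by blast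
        have e: "poly p a = poly r a" using m(3) unfolding ur(3) by simp
        hence "r \<noteq> 0" using less.prems by auto
        hence "degree r < degree p" using ur(4) ge by auto
        from less.hyps[OF this ur(2)] show ?thesis using e less.prems by auto
      qed
    qed
  qed
  show ?thesis unfolding is_subfield_def
  proof (intro conjI ballI)
    have "[:1:] \<in> polys_over K" by (intro cl subfield_closed[OF K])
    thus "1 \<in> ?K" by (intro image_eqI[of _ _ "[:1:]"]) auto
  next
    fix x y assume "x \<in> ?K" "y \<in> ?K"
    then obtain p q where pq: "p \<in> polys_over K" "q \<in> polys_over K" "x = poly p a" "y = poly q a" by blast
    show "x - y \<in> ?K" using pq cl by (intro image_eqI[of _ _ "p - q"]) auto
    show "x * y \<in> ?K" using pq cl by (intro image_eqI[of _ _ "p * q"]) auto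
  next
    fix x assume "x \<in> ?K"
    then obtain p where p: "p \<in> polys_over K" "x = poly p a" by blast
    show "inverse x \<in> ?K"
    proof (cases "x = 0")
      case True
      thus ?thesis using cl by (intro image_eqI[of _ _ 0]) auto
    next
      case False
      then obtain q where "q \<in> polys_over K" "x * poly q a = 1" using inv p by blast
      thus ?thesis by (intro image_eqI[of _ _ q]) (auto simp: inverse_unique)
    qed
  qed
qed

text \<open>Evaluation at \<open>a\<close> is replaced by evaluation of the transported polynomial
  at \<open>b\<close>. Two representatives of one element differ by a multiple of \<open>m\<close>,
  whose image vanishes at \<open>b\<close>, so the representative chosen by \<open>SOME\<close> is
  immaterial.\<close>

lemma field_hom_on_simple_extension:
  assumes K: "is_subfield K" and \<tau>: "field_hom_on K \<tau>"
    and m: "m \<in> polys_over K" "m \<noteq> 0" "poly m a = 0"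
    and min: "\<forall>p\<in>polys_over K. p \<noteq> 0 \<longrightarrow> poly p a = 0 \<longrightarrow> degree m \<le> degree p"
    and b: "poly (map_poly \<tau> m) b = 0"
  shows "\<exists>L \<sigma>. is_subfield L \<and> field_hom_on L \<sigma> \<and> K \<subseteq> L \<and> a \<in> L \<and> (\<forall>x\<in>K. \<sigma> x = \<tau> x) \<and> \<sigma> a = b"
proof -
  note cl = polys_over_closed[OF K]
  define L where "L = (\<lambda>p. poly p a) ` polys_over K"
  define \<sigma> where "\<sigma> = (\<lambda>x. poly (map_poly \<tau> (SOME p. p \<in> polys_over K \<and> poly p a = x)) b)"
  have wd: "poly (map_poly \<tau> p) b = poly (map_poly \<tau> q) b"
    if "p \<in> polys_over K" "q \<in> polys_over K" "poly p a = poly q a" for p q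
  proof -
    have pq: "p - q \<in> polys_over K" using cl that by blast
    obtain u r where ur: "u \<in> polys_over K" "r \<in> polys_over K" "p - q = m * u + r"
      "r = 0 \<or> degree r < degree m"
      using polys_over_division[OF K m(1,2) pq] by blast
    have "poly r a = poly (p - q) a" unfolding ur(3) using m(3) by simp
    hence "poly r a = 0" using that(3) by simp
    hence "r = 0" using min[rule_format, OF ur(2)] ur(4) by force
    hence "map_poly \<tau> (p - q) = map_poly \<tau> m * map_poly \<tau> u"
      using ur map_poly_hom_on(3)[OF K \<tau> m(1) ur(1)] by simp
    hence "poly (map_poly \<tau> (p - q)) b = 0" using b by simp
    thus ?thesis using map_poly_hom_on(2)[OF K \<tau> that(1,2)] by simp
  qed
  have \<sigma>: "\<sigma> (poly p a) = poly (map_poly \<tau> p) b" if "p \<in> polys_over K" for p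
  proof -
    let ?q = "SOME q. q \<in> polys_over K \<and> poly q a = poly p a"
    have "?q \<in> polys_over K \<and> poly ?q a = poly p a" by (rule someI[of _ p]) (use that in auto)
    thus ?thesis using wd that unfolding \<sigma>_def by blast
  qed
  have L: "is_subfield L" unfolding L_def by (rule subfield_simple_extension[OF K m min])
  have const: "[:c:] \<in> polys_over K" if "c \<in> K" for c using that by (intro cl)
  note mp = Polynomial.map_poly_pCons[of \<tau>, OF field_hom_onD(2)[OF K \<tau>]]
  have ext: "\<sigma> x = \<tau> x" "x \<in> L" if "x \<in> K" for x
  proof -
    show "\<sigma> x = \<tau> x" using \<sigma>[OF const[OF that]] by (simp add: mp)
    show "x \<in> L" unfolding L_def using const[OF that] by (intro image_eqI[of _ _ "[:x:]"]) auto
  qed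
  have "field_hom_on L \<sigma>" unfolding field_hom_on_def
  proof (intro conjI ballI)
    show "\<sigma> 1 = 1" using ext(1)[of 1] subfield_closed(1)[OF K] field_hom_onD(1)[OF K \<tau>] by simp
  next
    fix x y assume "x \<in> L" "y \<in> L"
    then obtain p q where pq: "p \<in> polys_over K" "q \<in> polys_over K" "x = poly p a" "y = poly q a"
      by (auto simp: L_def)
    show "\<sigma> (x + y) = \<sigma> x + \<sigma> y"
      using \<sigma>[of "p + q"] \<sigma>[OF pq(1)] \<sigma>[OF pq(2)] pq cl map_poly_hom_on(1)[OF K \<tau> pq(1,2)] by simp
    show "\<sigma> (x * y) = \<sigma> x * \<sigma> y"
      using \<sigma>[of "p * q"] \<sigma>[OF pq(1)] \<sigma>[OF pq(2)] pq cl map_poly_hom_on(3)[OF K \<tau> pq(1,2)] by simp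
  qed
  moreover have X: "[:0, 1:] \<in> polys_over K" by (intro cl subfield_closed[OF K])
  hence "a \<in> L" unfolding L_def by (intro image_eqI[of _ _ "[:0,1:]"]) auto
  moreover have "\<sigma> a = b"
    using \<sigma>[OF X] field_hom_onD(1,2)[OF K \<tau>] by (simp add: mp)
  ultimately show ?thesis using L ext by blast
qed

text \<open>One element is adjoined at a time, through a polynomial of least degree over the field
  reached so far. The target is \<open>complex\<close> so that the transported polynomial has a root
  to serve as image.\<close>

lemma field_hom_on_extend:
  fixes \<tau> :: "'a::field \<Rightarrow> complex"
  assumes K: "is_subfield K" and \<tau>: "field_hom_on K \<tau>" and "finite S"
    and alg: "\<forall>a\<in>S. \<exists>p\<in>polys_over K. p \<noteq> 0 \<and> poly p a = 0"
  shows "\<exists>L \<sigma>. is_subfield L \<and> field_hom_on L \<sigma> \<and> K \<subseteq> L \<and> S \<subseteq> L \<and> (\<forall>x\<in>K. \<sigma> x = \<tau> x)"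
  using \<open>finite S\<close> alg
proof (induction S rule: finite_induct)
  case empty
  then show ?case using K \<tau> by blast
next
  case (insert a S)
  obtain L \<sigma> where L: "is_subfield L" "field_hom_on L \<sigma>" "K \<subseteq> L" "S \<subseteq> L" "\<forall>x\<in>K. \<sigma> x = \<tau> x"
    using insert.IH insert.prems by auto
  define P where "P = (\<lambda>p. p \<in> polys_over L \<and> p \<noteq> 0 \<and> poly p a = 0)"
  have "polys_over K \<subseteq> polys_over L" using L(3) by (auto simp: polys_over_def)
  hence "\<exists>p. P p" using insert.prems unfolding P_def by auto
  then obtain m where m: "P m" "\<And>p. P p \<Longrightarrow> degree m \<le> degree p"
    using arg_min_nat_lemma[of P _ degree] by metis
  have m': "m \<in> polys_over L" "m \<noteq> 0" "poly m a = 0" using m(1) by (auto simp: P_def)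
  have min: "\<forall>p\<in>polys_over L. p \<noteq> 0 \<longrightarrow> poly p a = 0 \<longrightarrow> degree m \<le> degree p"
    using m(2) by (simp add: P_def)
  note h = field_hom_onD[OF L(1,2)]
  have "lead_coeff m \<in> L" using m' by (auto simp: polys_over_def)
  hence "\<sigma> (lead_coeff m) \<noteq> 0" using h(7) m'(2) by simp
  hence "degree (map_poly \<sigma> m) = degree m" using m'(2)
    by (intro map_poly_degree_eq) auto
  moreover have "degree m > 0"
  proof (rule ccontr)
    assume "\<not> degree m > 0"
    hence "degree m = 0" by simp
    then obtain c where "m = [:c:]" by (rule degree_eq_zeroE)
    thus False using m' by simp
  qed
  ultimately have "\<not> constant (poly (map_poly \<sigma> m))" by (simp add: constant_degree)
  then obtain b where b: "poly (map_poly \<sigma> m) b = 0"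
    using fundamental_theorem_of_algebra by blast
  obtain L' \<sigma>' where L': "is_subfield L'" "field_hom_on L' \<sigma>'" "L \<subseteq> L'" "a \<in> L'"
    "\<forall>x\<in>L. \<sigma>' x = \<sigma> x"
    using field_hom_on_simple_extension[OF L(1,2) m' min b] by metis
  have "K \<subseteq> L'" "insert a S \<subseteq> L'" "\<forall>x\<in>K. \<sigma>' x = \<tau> x" using L(3-5) L'(3-5) by auto
  thus ?case using L'(1,2) by blast
qed

text \<open>Irreducible elements of \<open>int poly\<close> are prime, and a \<open>p\<close> of
  positive degree divides no nonzero constant. Pseudo-division by an annihilator \<open>f\<close> of
  least degree turns every annihilator \<open>g\<close> into \<open>c * g = f * u\<close>; this
  gives \<open>p dvd f\<close> first and then \<open>p dvd q\<close>.\<close>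

lemma int_poly_dvd_if_common_root:
  fixes p q :: "int poly" and a :: "'a::{field_char_0}"
  assumes "irreducible p" "degree p > 0" "poly (map_poly of_int p) a = 0"
    and "poly (map_poly of_int q) a = 0"
  shows "p dvd q"
proof -
  define P where "P = (\<lambda>f :: int poly. f \<noteq> 0 \<and> poly (map_poly of_int f) a = 0)"
  have "P p" using assms by (auto simp: P_def)
  then obtain f where f: "P f" "\<And>g. P g \<Longrightarrow> degree f \<le> degree g"
    using ex_has_least_nat[of P _ degree] by metis
  have hm: "map_poly of_int (smult c u) = smult (of_int c) (map_poly of_int u :: 'a poly)"
    "map_poly of_int (u * v) = (map_poly of_int u * map_poly of_int v :: 'a poly)"
    "map_poly of_int (u + v) = (map_poly of_int u + map_poly of_int v :: 'a poly)" for c u v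
    by (auto intro!: poly_eqI simp: coeff_map_poly coeff_mult)
  have div: "\<exists>c u. c \<noteq> 0 \<and> smult c g = f * u" if "poly (map_poly of_int g) a = 0" for g
  proof -
    obtain c u where cu: "c \<noteq> 0" "smult c g = f * u + pseudo_mod g f"
      using pseudo_mod(1)[of f g] f(1) by (auto simp: P_def)
    let ?r = "pseudo_mod g f"
    have "poly (map_poly of_int (smult c g)) a = (0::'a)" using that by (simp add: hm)
    hence "poly (map_poly of_int ?r) a = (0::'a)" using f(1) unfolding cu(2) by (simp add: hm P_def)
    hence "?r = 0" using pseudo_mod(2)[of f g] f by (force simp: P_def)
    thus ?thesis using cu by auto
  qed
  have pe: "prime_elem p" using assms(1) by (rule irreducible_imp_prime_elem)
  have nconst: "\<not> p dvd [:c:]" if "c \<noteq> 0" for c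
  proof
    assume "p dvd [:c:]"
    hence "degree p \<le> degree [:c:]" using that by (intro dvd_imp_degree_le) auto
    thus False using assms(2) by simp
  qed
  have "p dvd f"
  proof -
    obtain c u where cu: "c \<noteq> 0" "smult c p = f * u" using div assms(3) by blast
    have "p dvd f * u" using cu(2) by (metis dvd_smult dvd_refl)
    \<comment> \<open>Otherwise \<open>f\<close> would divide the constant \<open>c\<close>, hence
      be constant itself, yet it is nonzero and vanishes at \<open>a\<close>.\<close>
    moreover have "\<not> p dvd u"
    proof
      assume "p dvd u"
      then obtain v where v: "u = p * v" by (elim dvdE)
      have pn: "p \<noteq> 0" "f \<noteq> 0" using assms(2) f(1) by (auto simp: P_def)
      have "p * [:c:] = p * (f * v)" using cu(2) v by (simp add: algebra_simps)
      hence fv: "f * v = [:c:]" using mult_left_cancel[OF pn(1)] by metis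
      hence "v \<noteq> 0" using cu(1) by auto
      hence "degree f + degree v = 0" using fv pn(2) degree_mult_eq[of f v] by simp
      hence "degree f = 0" by simp
      then obtain e where "f = [:e:]" by (metis degree_eq_zeroE)
      thus False using f(1) by (auto simp: P_def Polynomial.map_poly_pCons)
    qed
    ultimately show ?thesis using pe by (simp add: prime_elem_dvd_mult_iff)
  qed
  obtain c u where cu: "c \<noteq> 0" "smult c q = f * u" using div assms(4) by blast
  hence "p dvd [:c:] * q" using \<open>p dvd f\<close> by simp
  thus ?thesis using nconst[OF cu(1)] by (simp only: prime_elem_dvd_mult_iff[OF pe] simp_thms)
qed

section \<open>Conjugation of the roots of an irreducible integer polynomial\<close>

lemma is_subfield_Rats: "is_subfield (\<rat> :: 'a::field_char_0 set)"
  by (auto simp: is_subfield_def)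

lemma clear_denominators:
  fixes q :: "'a::field_char_0 poly"
  assumes "q \<in> polys_over \<rat>"
  shows "\<exists>c p. c \<noteq> 0 \<and> map_poly of_int p = smult (of_int c) q"
proof -
  have "\<exists>c::int. c \<noteq> 0 \<and> (\<exists>n::int. of_int c * coeff q i = of_int n)" for i
  proof -
    have "coeff q i \<in> \<rat>" using assms by (auto simp: polys_over_def)
    then obtain a b where "b > 0" "coeff q i = of_int a / of_int b" by (elim Rats_cases')
    thus ?thesis by (intro exI[of _ b]) auto
  qed
  then obtain c where c: "\<And>i. c i \<noteq> (0::int)" "\<And>i. \<exists>n::int. of_int (c i) * coeff q i = of_int n"
    by metis
  define C where "C = (\<Prod>i\<le>degree q. c i)"
  have "\<exists>n::int. of_int C * coeff q i = of_int n" for i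
  proof (cases "i \<le> degree q")
    case True
    obtain n :: int where n: "of_int (c i) * coeff q i = of_int n" using c(2) by blast
    have "C = c i * (\<Prod>j\<in>{..degree q} - {i}. c j)" unfolding C_def using True by (simp add: prod.remove)
    hence "of_int C * coeff q i = (of_int (c i) * coeff q i) * of_int (\<Prod>j\<in>{..degree q} - {i}. c j)"
      by simp
    thus ?thesis unfolding n of_int_mult[symmetric] by blast
  next
    case False
    thus ?thesis by (intro exI[of _ 0]) (auto simp: coeff_eq_0)
  qed
  then obtain n :: "nat \<Rightarrow> int" where n: "\<And>i. of_int C * coeff q i = of_int (n i)" by metis
  define p where "p = Poly (map n [0..<Suc (degree q)])"
  have "coeff p i = n i" for i
  proof (cases "i \<le> degree q")
    case True
    thus ?thesis by (auto simp: p_def nth_default_def simp del: upt_Suc)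
  next
    case False
    have "n i = 0" using n[of i] False by (simp add: coeff_eq_0)
    thus ?thesis using False by (auto simp: p_def nth_default_def simp del: upt_Suc)
  qed
  hence "map_poly of_int p = smult (of_int C) q"
    by (intro poly_eqI) (simp add: coeff_map_poly n)
  moreover have "C \<noteq> 0" using c(1) by (simp add: C_def)
  ultimately show ?thesis by blast
qed

text \<open>This plays the role of a Galois group element. Irreducibility makes \<open>p\<close> of
  least degree among rational polynomials vanishing at \<open>a\<close>, so any root
  \<open>b\<close> is a possible image; the embedding maps roots to roots because it fixes the
  coefficients of \<open>p\<close>.\<close>

lemma conjugation_hom:
  fixes p :: "int poly" and a b :: complex
  assumes p: "irreducible p" "degree p > 0"
    and a: "poly (map_poly of_int p) a = 0" and b: "poly (map_poly of_int p) b = 0"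
  shows "\<exists>L \<sigma>. is_subfield L \<and> field_hom_on L \<sigma> \<and> {z. poly (map_poly of_int p) z = 0} \<subseteq> L \<and> \<sigma> a = b
    \<and> (\<forall>z. poly (map_poly of_int p) z = 0 \<longrightarrow> poly (map_poly of_int p) (\<sigma> z) = 0)"
proof -
  let ?m = "map_poly of_int p :: complex poly"
  have m0: "?m \<noteq> 0" using p by (auto simp: map_poly_eq_0_iff)
  have mR: "?m \<in> polys_over \<rat>" by (auto simp: polys_over_def coeff_map_poly)
  have id: "field_hom_on \<rat> (\<lambda>x::complex. x)" by (auto simp: field_hom_on_def)
  have dm: "degree (map_poly of_int f :: complex poly) = degree f" for f :: "int poly"
    by (intro degree_map_poly) auto
  have min: "\<forall>q\<in>polys_over \<rat>. q \<noteq> 0 \<longrightarrow> poly q a = 0 \<longrightarrow> degree ?m \<le> degree q"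
  proof (intro ballI impI)
    fix q :: "complex poly" assume q: "q \<in> polys_over \<rat>" "q \<noteq> 0" "poly q a = 0"
    obtain c f where cf: "c \<noteq> 0" "map_poly of_int f = smult (of_int c) q"
      using clear_denominators[OF q(1)] by blast
    have "poly (map_poly of_int f) a = 0" using q(3) unfolding cf(2) by simp
    hence "p dvd f" using int_poly_dvd_if_common_root[OF p a] by blast
    moreover have "f \<noteq> 0" using cf q(2) by auto
    ultimately have "degree p \<le> degree f" by (rule dvd_imp_degree_le)
    also have "degree f = degree q" using dm[of f] cf by simp
    finally show "degree ?m \<le> degree q" by (simp add: dm)
  qed
  have b': "poly (map_poly (\<lambda>x. x) ?m) b = 0" using b by (simp add: map_poly_idI)
  obtain K \<tau> where K: "is_subfield K" "field_hom_on K \<tau>" "\<rat> \<subseteq> K" "a \<in> K"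
    "\<forall>x\<in>\<rat>. \<tau> x = x" "\<tau> a = b"
    using field_hom_on_simple_extension[OF is_subfield_Rats id mR m0 a min b'] by metis
  have fin: "finite {z. poly ?m z = 0}" using m0 by (rule poly_roots_finite)
  have mK: "?m \<in> polys_over K" using mR K(3) by (auto simp: polys_over_def)
  have alg: "\<forall>z\<in>{z. poly ?m z = 0}. \<exists>q\<in>polys_over K. q \<noteq> 0 \<and> poly q z = 0"
    using mK m0 by auto
  obtain L \<sigma> where L: "is_subfield L" "field_hom_on L \<sigma>" "K \<subseteq> L"
    "{z. poly ?m z = 0} \<subseteq> L" "\<forall>x\<in>K. \<sigma> x = \<tau> x"
    using field_hom_on_extend[OF K(1,2) fin alg] by (elim exE conjE) (rule that)
  have "map_poly \<sigma> ?m = ?m"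
    using field_hom_onD(2)[OF L(1,2)] L(5) K(3,5) Rats_of_int
    by (intro poly_eqI) (simp add: coeff_map_poly subset_iff)
  moreover have mL: "?m \<in> polys_over L" using mK L(3) by (auto simp: polys_over_def)
  ultimately have "poly ?m (\<sigma> z) = \<sigma> (poly ?m z)" if "z \<in> L" for z
    using map_poly_hom_on(4)[OF L(1,2) mL mL that] by simp
  hence "poly ?m (\<sigma> z) = 0" if "poly ?m z = 0" for z
    using that L(4) field_hom_onD(2)[OF L(1,2)] by auto
  moreover have "\<sigma> a = b" using L(5) K(4,6) by simp
  ultimately show ?thesis using L(1,2,4) by blast
qed

section \<open>Polynomials with prescribed roots\<close>

lemma monic_poly_eq_prod_roots:
  fixes f :: "'a::field poly"
  assumes "lead_coeff f = 1" "finite S" "card S = degree f" "\<forall>z\<in>S. poly f z = 0"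
  shows "f = (\<Prod>z\<in>S. [:- z, 1:])"
proof -
  let ?q = "\<Prod>z\<in>S. [:- z, 1:] :: 'a poly"
  have dq: "degree ?q = degree f" using assms(3) by (simp add: degree_prod_sum_eq)
  have lq: "lead_coeff ?q = 1" by (simp only: lead_coeff_prod) simp
  have "f - ?q = 0"
  proof (rule ccontr)
    assume ne: "f - ?q \<noteq> 0"
    have "coeff (f - ?q) (degree f) = 0" using assms(1) dq lq by simp
    moreover have "degree (f - ?q) \<le> degree f" using dq by (intro degree_diff_le) auto
    ultimately have lt: "degree (f - ?q) < degree f"
      using ne by (metis le_neq_implies_less leading_coeff_0_iff)
    have "S \<subseteq> {x. poly (f - ?q) x = 0}"
      using assms(2,4) by (auto simp: poly_prod)
    hence "card S \<le> card {x. poly (f - ?q) x = 0}"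
      using poly_roots_finite[OF ne] by (rule card_mono[rotated])
    also have "\<dots> \<le> degree (f - ?q)" using ne by (rule card_poly_roots_bound)
    finally show False using lt assms(3) by simp
  qed
  thus ?thesis by simp
qed

text \<open>The characteristic polynomial of an integer matrix replaces the argument with symmetric
  functions. Injectivity of the \<open>m\<close>-th power gives \<open>d\<close> distinct
  eigenvalues, which determine a monic polynomial of degree \<open>d\<close>.\<close>

lemma int_poly_of_power_roots:
  fixes p :: "int poly" and S :: "complex set"
  assumes p: "lead_coeff p = 1" "degree p = d"
    and S: "\<forall>z\<in>S. poly (map_poly of_int p) z = 0" "inj_on (\<lambda>z. z ^ m) S" "card S = d" "d > 0"
  shows "\<exists>q :: int poly. map_poly of_int q = (\<Prod>z\<in>S. [:- (z ^ m), 1:])"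
proof -
  \<comment> \<open>As \<open>p\<close> is monic, pseudo-division scales by 1, so this is the true
    remainder over the integers.\<close>
  define r where "r i = pseudo_mod (monom 1 (m + i)) p" for i :: nat
  have p0: "p \<noteq> 0" using p S(4) by auto
  have r: "\<exists>u. monom 1 (m + i) = p * u + r i" "degree (r i) < d" for i
  proof -
    obtain u v where uv: "pseudo_divmod (monom 1 (m + i)) p = (u, v)" by fastforce
    have rv: "r i = v" unfolding r_def pseudo_mod_def uv by simp
    have "monom 1 (m + i) = p * u + r i" using pseudo_divmod(1)[OF p0 uv] p(1) by (simp add: rv)
    thus "\<exists>u. monom 1 (m + i) = p * u + r i" by blast
    show "degree (r i) < d" using pseudo_divmod(2)[OF p0 uv] p(2) S(4) by (auto simp: rv)
  qed
  \<comment> \<open>Multiplication by \<open>x ^ m\<close> on \<open>\<int>[x] / (p)\<close>; the vector of powers of a root \<open>z\<close> is an eigenvector for \<open>z ^ m\<close>.\<close>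
  define A where "A = Matrix.mat d d (\<lambda>(i, j). coeff (r i) j)"
  have A: "A \<in> carrier_mat d d" by (simp add: A_def)
  define B where "B = map_mat (of_int :: int \<Rightarrow> complex) A"
  have B: "B \<in> carrier_mat d d" using A by (simp add: B_def)
  have ev: "eigenvalue B (z ^ m)" if "z \<in> S" for z
  proof -
    define v where "v = Matrix.vec d (\<lambda>j. z ^ j)"
    have "vec_index v 0 = 1" using S(4) by (simp add: v_def)
    hence v0: "v \<noteq> 0\<^sub>v d" using S(4) by auto
    have row: "(\<Sum>j<d. of_int (coeff (r i) j) * z ^ j) = z ^ (m + i)" for i
    proof -
      obtain u where u: "monom 1 (m + i) = p * u + r i" using r(1) by blast
      have hm: "map_poly of_int (f * g + h) = (map_poly of_int f * map_poly of_int g + map_poly of_int h :: complex poly)"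
        for f g h :: "int poly"
        by (auto intro!: poly_eqI simp: coeff_map_poly coeff_mult)
      have "z ^ (m + i) = poly (map_poly of_int (monom 1 (m + i) :: int poly)) z"
        by (simp add: map_poly_monom poly_monom)
      also have "\<dots> = poly (map_poly of_int (r i)) z"
        unfolding u hm using S(1) that by simp
      also have "\<dots> = (\<Sum>j<d. of_int (coeff (r i) j) * z ^ j)"
        unfolding poly_altdef using r(2)[of i]
        by (intro sum.mono_neutral_cong_left) (auto simp: coeff_map_poly coeff_eq_0 degree_map_poly)
      finally show ?thesis ..
    qed
    have "B *\<^sub>v v = (z ^ m) \<cdot>\<^sub>v v"
    proof (rule eq_vecI)
      fix i assume "i < dim_vec ((z ^ m) \<cdot>\<^sub>v v)"
      hence i: "i < d" by (simp add: v_def)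
      have "vec_index (B *\<^sub>v v) i = (\<Sum>j<d. of_int (coeff (r i) j) * z ^ j)"
        using i by (simp add: B_def A_def v_def scalar_prod_def atLeast0LessThan)
      thus "vec_index (B *\<^sub>v v) i = vec_index ((z ^ m) \<cdot>\<^sub>v v) i"
        using i by (simp add: row v_def power_add)
    qed (use B in \<open>auto simp: v_def\<close>)
    hence "eigenvector B v (z ^ m)" unfolding eigenvector_def using v0 B by (auto simp: v_def)
    thus ?thesis unfolding eigenvalue_def by blast
  qed
  define c where "c = char_poly B"
  have c: "c = map_poly of_int (char_poly A)" unfolding c_def B_def by (rule of_int_hom.char_poly_hom[OF A])
  have dc: "degree c = d" "lead_coeff c = 1" using degree_monic_char_poly[OF B] by (auto simp: c_def)
  have root: "poly c (z ^ m) = 0" if "z \<in> S" for z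
    using ev[OF that] eigenvalue_root_char_poly[OF B] by (simp add: c_def)
  have fS: "finite S" using S(3,4) card.infinite by fastforce
  have "c = (\<Prod>x\<in>(\<lambda>z. z ^ m) ` S. [:- x, 1:])"
    using dc root fS S(2,3) by (intro monic_poly_eq_prod_roots) (auto simp: card_image)
  also have "\<dots> = (\<Prod>z\<in>S. [:- (z ^ m), 1:])" by (simp add: prod.reindex[OF S(2)])
  finally show ?thesis using c by metis
qed

section \<open>Products over pairs of complex conjugate roots\<close>

lemma upper_half_plane_Int_cnj:
  assumes "\<forall>z\<in>A. Im z > 0"
  shows "A \<inter> cnj ` A = {}"
proof (rule equals0I)
  fix z assume "z \<in> A \<inter> cnj ` A"
  then obtain w where w: "z \<in> A" "w \<in> A" "z = cnj w" by blast
  have "Im z > 0" "Im w > 0" using assms w(1,2) by blast+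
  thus False using w(3) by simp
qed

lemma prod_Un_cnj:
  assumes "finite A" "\<forall>z\<in>A. Im z > 0"
  shows "prod f (A \<union> cnj ` A) = (\<Prod>z\<in>A. f z * f (cnj z))"
proof -
  have "A \<inter> cnj ` A = {}" by (rule upper_half_plane_Int_cnj[OF assms(2)])
  hence "prod f (A \<union> cnj ` A) = prod f A * prod f (cnj ` A)"
    using assms(1) by (intro prod.union_disjoint) auto
  also have "prod f (cnj ` A) = (\<Prod>z\<in>A. f (cnj z))"
    by (subst prod.reindex) (auto intro: inj_onI)
  finally show ?thesis by (simp add: prod.distrib)
qed

lemma card_Un_cnj:
  assumes "finite A" "\<forall>z\<in>A. Im z > 0"
  shows "card (A \<union> cnj ` A) = 2 * card A"
proof -
  have "A \<inter> cnj ` A = {}" by (rule upper_half_plane_Int_cnj[OF assms(2)])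
  moreover have "card (cnj ` A) = card A" by (intro card_image inj_onI) simp
  ultimately show ?thesis using assms(1) by (simp add: card_Un_disjoint)
qed

lemma map_poly_of_real_mult:
  "map_poly complex_of_real (p * q) = map_poly complex_of_real p * map_poly complex_of_real q"
  by (rule poly_eqI) (simp add: coeff_map_poly coeff_mult)

lemma map_poly_of_real_prod:
  "map_poly complex_of_real (prod f A) = (\<Prod>x\<in>A. map_poly complex_of_real (f x))"
  by (induction A rule: infinite_finite_induct) (auto simp: map_poly_of_real_mult)

lemma cis_pair_quadratic:
  "[:- cis t, 1:] * [:- cnj (cis t), 1:] = map_poly complex_of_real [:1, - (2 * cos t), 1:]"
proof -
  have "cis t * cnj (cis t) = 1" by (simp add: cis_cnj cis_mult)
  moreover have "cis t + cnj (cis t) = of_real (2 * cos t)" by (simp add: complex_eq_iff)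
  ultimately show ?thesis by (simp add: Polynomial.map_poly_pCons algebra_simps)
qed

text \<open>
  The polynomial \<open>x\<^sup>2\<^sup>k + (x\<^sup>2\<^sup>k\<^sup>-\<^sup>1 + \<dots> + x) / (2k) + 1\<close>, divided by \<open>x\<^sup>k\<close>, is real on the unit circle
  and differs there from \<open>2 cos (k t)\<close> by less than 1. Hence it changes sign \<open>k\<close> times on \<open>(0, \<pi>)\<close>,
  so all its roots are simple and unimodular.
\<close>

lemma palindromic_unimodular_polynomial:
  fixes k :: nat
  assumes "k \<ge> 1"
  shows "\<exists>\<phi>::nat \<Rightarrow> real. \<forall>i. coeff (\<Prod>j<k. [:1, - (2 * cos (\<phi> j)), 1:]) i =
    (if i = 0 \<or> i = 2 * k then 1 else if i < 2 * k then 1 / (2 * real k) else 0)"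
proof -
  define r where "r i = (if i = 0 \<or> i = 2 * k then 1 else 1 / (2 * real k))" for i
  define Q where "Q = (\<Sum>i\<le>2 * k. monom (complex_of_real (r i)) i)"
  define h where "h t = (\<Sum>i\<le>2 * k. r i * cos ((real i - real k) * t))" for t
  have coeffQ: "coeff Q i = (if i \<le> 2 * k then of_real (r i) else 0)" for i
    by (simp add: Q_def coeff_sum)
  have Qh: "poly Q (cis t) = cis (real k * t) * of_real (h t)" for t
  proof -
    \<comment> \<open>\<open>r\<close> is symmetric under the reflection of \<open>i\<close> to
      \<open>2 * k - i\<close> while the sine is odd, so the sum equals its own negative.\<close>
    have "(\<Sum>i\<le>2 * k. r i * sin ((real i - real k) * t)) = (\<Sum>i\<le>2 * k. r i * sin ((real k - real i) * t))"
      by (rule sum.reindex_bij_witness[where i = "\<lambda>i. 2 * k - i" and j = "\<lambda>i. 2 * k - i"])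
        (auto simp: r_def of_nat_diff algebra_simps)
    also have "\<dots> = - (\<Sum>i\<le>2 * k. r i * sin ((real i - real k) * t))"
    proof -
      have "sin ((real k - real i) * t) = - sin ((real i - real k) * t)" for i
        by (subst sin_minus[symmetric]) (simp add: algebra_simps)
      thus ?thesis by (simp add: sum_negf)
    qed
    finally have s0: "(\<Sum>i\<le>2 * k. r i * sin ((real i - real k) * t)) = 0" by simp
    have hsum: "(\<Sum>i\<le>2 * k. of_real (r i) * cis ((real i - real k) * t)) = of_real (h t)"
      using s0 by (simp add: complex_eq_iff h_def)
    have "poly Q (cis t) = (\<Sum>i\<le>2 * k. of_real (r i) * cis t ^ i)"
      by (simp add: Q_def poly_sum poly_monom)
    moreover have "cis t ^ i = cis (real k * t) * cis ((real i - real k) * t)" for i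
      by (simp add: Complex.DeMoivre cis_mult algebra_simps)
    ultimately have "poly Q (cis t) = (\<Sum>i\<le>2 * k. cis (real k * t) * (of_real (r i) * cis ((real i - real k) * t)))"
      by (simp add: mult.left_commute)
    thus ?thesis by (simp only: sum_distrib_left[symmetric] hsum)
  qed
  have near: "\<bar>h t - 2 * cos (real k * t)\<bar> < 1" for t
  proof -
    have "{..2 * k} = insert 0 (insert (2 * k) {0<..<2 * k})" using assms by auto
    hence "h t = 2 * cos (real k * t) + (\<Sum>i\<in>{0<..<2 * k}. r i * cos ((real i - real k) * t))"
      using assms by (simp add: h_def r_def algebra_simps)
    moreover have "\<bar>\<Sum>i\<in>{0<..<2 * k}. r i * cos ((real i - real k) * t)\<bar>
        \<le> (\<Sum>i\<in>{0<..<2 * k}. 1 / (2 * real k))"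
      by (rule order_trans[OF sum_abs], rule sum_mono)
        (auto simp: r_def abs_mult mult_le_one divide_right_mono)
    moreover have "(\<Sum>i\<in>{0<..<2 * k}. 1 / (2 * real k)) < 1"
      using assms by (simp add: field_simps)
    ultimately show ?thesis by linarith
  qed
  have hcont: "continuous_on X h" for X
    unfolding h_def by (intro continuous_intros)
  have "\<exists>t. real j * pi / k < t \<and> t < real (Suc j) * pi / k \<and> h t = 0" for j
  proof -
    \<comment> \<open>The sign makes every interval the same case: positive at the left end,
      negative at the right end. At the end points \<open>2 * cos (k * t)\<close> is 2 or -2, so an
      error below 1 cannot change the sign.\<close>
    define g where "g t = (- 1) ^ j * h t" for t
    have gj: "\<bar>g (real i * pi / k) - 2 * (- 1) ^ (i + j)\<bar> < 1" for i
    proof -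
      have "cos (real k * (real i * pi / real k)) = (- 1) ^ i" using assms by simp
      hence "\<bar>h (real i * pi / k) - 2 * (- 1) ^ i\<bar> < 1" using near[of "real i * pi / k"] by simp
      moreover have "g (real i * pi / k) - 2 * (- 1) ^ (i + j) = (- 1) ^ j * (h (real i * pi / k) - 2 * (- 1) ^ i)"
        by (simp add: g_def algebra_simps power_add)
      ultimately show ?thesis by (simp add: abs_mult power_abs)
    qed
    have gl: "g (real j * pi / k) > 0" and gr: "g (real (Suc j) * pi / k) < 0"
      using gj[of j] gj[of "Suc j"] by (simp_all add: mult_2[symmetric])
    have "continuous_on X g" for X unfolding g_def by (intro continuous_intros hcont)
    moreover have "real j * pi / k \<le> real (Suc j) * pi / k" by (intro divide_right_mono mult_right_mono) auto
    ultimately obtain t where t: "real j * pi / k \<le> t" "t \<le> real (Suc j) * pi / k" "g t = 0"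
      using IVT2'[of g "real (Suc j) * pi / k" 0 "real j * pi / k"] gl gr by (metis less_imp_le)
    have "t \<noteq> real j * pi / k" "t \<noteq> real (Suc j) * pi / k" using t(3) gl gr by auto
    thus ?thesis using t by (intro exI[of _ t]) (auto simp: g_def)
  qed
  then obtain \<phi> where \<phi>: "\<And>j. real j * pi / k < \<phi> j" "\<And>j. \<phi> j < real (Suc j) * pi / k" "\<And>j. h (\<phi> j) = 0"
    by metis
  have range: "0 < \<phi> j \<and> \<phi> j < pi" if "j < k" for j
  proof
    have "0 \<le> real j * pi / k" by simp
    thus "0 < \<phi> j" using \<phi>(1)[of j] by linarith
    have "real (Suc j) * pi / k \<le> real k * pi / k" using that by (intro divide_right_mono mult_right_mono) auto
    thus "\<phi> j < pi" using \<phi>(2)[of j] that by simp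
  qed
  have mono: "\<phi> i < \<phi> j" if "i < j" for i j
  proof -
    have "real (Suc i) * pi / k \<le> real j * pi / k" using that by (intro divide_right_mono mult_right_mono) auto
    thus ?thesis using \<phi>(1)[of j] \<phi>(2)[of i] by linarith
  qed
  have inj: "inj_on (\<lambda>j. cis (\<phi> j)) {..<k}"
  proof (rule inj_onI)
    fix i j assume ij: "i \<in> {..<k}" "j \<in> {..<k}" "cis (\<phi> i) = cis (\<phi> j)"
    hence "cos (\<phi> i) = cos (\<phi> j)" by (metis cis.simps(1))
    hence "\<phi> i = \<phi> j" using cos_inj_pi[of "\<phi> i" "\<phi> j"] range[of i] range[of j] ij by auto
    thus "i = j" using mono[of i j] mono[of j i] by linarith
  qed
  define A where "A = (\<lambda>j. cis (\<phi> j)) ` {..<k}"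
  have A: "finite A" "\<forall>z\<in>A. Im z > 0" "card A = k"
    using range sin_gt_zero inj by (auto simp: A_def card_image)
  have "poly Q z = 0" if "z \<in> A \<union> cnj ` A" for z
  proof -
    have "h (- t) = h t" for t by (simp add: h_def)
    thus ?thesis using that \<phi>(3) by (auto simp: A_def cis_cnj Qh)
  qed
  moreover have dQ: "degree Q = 2 * k"
    by (intro antisym degree_le le_degree) (auto simp: coeffQ r_def)
  moreover have "lead_coeff Q = 1" using dQ by (simp add: coeffQ r_def)
  ultimately have "Q = (\<Prod>z\<in>A \<union> cnj ` A. [:- z, 1:])"
    using A card_Un_cnj[OF A(1,2)] by (intro monic_poly_eq_prod_roots) auto
  also have "\<dots> = (\<Prod>z\<in>A. [:- z, 1:] * [:- cnj z, 1:])" by (rule prod_Un_cnj[OF A(1,2)])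
  also have "\<dots> = (\<Prod>j<k. [:- cis (\<phi> j), 1:] * [:- cnj (cis (\<phi> j)), 1:])"
    unfolding A_def by (simp only: prod.reindex[OF inj] o_def)
  also have "\<dots> = map_poly complex_of_real (\<Prod>j<k. [:1, - (2 * cos (\<phi> j)), 1:])"
    by (simp only: cis_pair_quadratic map_poly_of_real_prod)
  finally have Q: "Q = map_poly complex_of_real (\<Prod>j<k. [:1, - (2 * cos (\<phi> j)), 1:])" .
  have "coeff (\<Prod>j<k. [:1, - (2 * cos (\<phi> j)), 1:]) i =
    (if i = 0 \<or> i = 2 * k then 1 else if i < 2 * k then 1 / (2 * real k) else 0)" for i
  proof -
    have "complex_of_real (coeff (\<Prod>j<k. [:1, - (2 * cos (\<phi> j)), 1:]) i) = coeff Q i"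
      unfolding Q by (simp add: coeff_map_poly)
    also have "\<dots> = of_real (if i = 0 \<or> i = 2 * k then 1 else if i < 2 * k then 1 / (2 * real k) else 0)"
      by (auto simp: coeffQ r_def)
    finally show ?thesis using of_real_eq_iff by blast
  qed
  thus ?thesis by blast
qed

section \<open>Stability of the coefficient condition under small changes of the angles\<close>

lemma tendsto_coeff_prod_quadratics:
  fixes c :: "'a \<Rightarrow> nat \<Rightarrow> real"
  assumes "\<And>j. j < k \<Longrightarrow> ((\<lambda>n. c n j) \<longlongrightarrow> c0 j) F"
  shows "((\<lambda>n. coeff (\<Prod>j<k. [:1, - (c n j), 1:]) i) \<longlongrightarrow> coeff (\<Prod>j<k. [:1, - (c0 j), 1:]) i) F"
  using assms
proof (induction k arbitrary: i)
  case 0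
  show ?case by simp
next
  case (Suc k)
  have quad: "((\<lambda>n. coeff [:1, - (c n k), 1:] l) \<longlongrightarrow> coeff [:1, - (c0 k), 1:] l) F" for l
  proof (cases "l = 1")
    case True
    thus ?thesis using Suc.prems[of k] by (auto intro: tendsto_minus)
  next
    case False
    thus ?thesis by (cases l) (auto simp: coeff_pCons split: nat.split)
  qed
  show ?case
    unfolding prod.lessThan_Suc coeff_mult
    by (intro tendsto_sum tendsto_mult quad Suc.IH Suc.prems) auto
qed

text \<open>Continuity of finitely many coefficients, by contradiction along a sequence of
  tolerances \<open>1 / (n + 1)\<close>. Angles are measured in turns and compared modulo 1, as
  suits multiples of a rotation. The window \<open>1 / (4 * k)\<close> puts the coefficients between
  \<open>1 / (4 * k)\<close> and \<open>3 / (4 * k)\<close>, away from 0 and below 3/4.\<close>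

lemma unimodular_neighbourhood:
  fixes k :: nat
  assumes "k \<ge> 1"
  shows "\<exists>(\<phi>::nat \<Rightarrow> real) \<epsilon>. \<epsilon> > 0 \<and> (\<forall>\<psi>. (\<forall>j<k. \<exists>h::int. \<bar>\<psi> j - of_int h - \<phi> j\<bar> < \<epsilon>) \<longrightarrow>
    (\<forall>i\<in>{0<..<2 * k}. \<bar>coeff (\<Prod>j<k. [:1, - (2 * cos (2 * pi * \<psi> j)), 1:]) i - 1 / (2 * real k)\<bar> < 1 / (4 * real k)))"
proof -
  obtain \<phi>' :: "nat \<Rightarrow> real" where \<phi>': "\<And>i. coeff (\<Prod>j<k. [:1, - (2 * cos (\<phi>' j)), 1:]) i =
    (if i = 0 \<or> i = 2 * k then 1 else if i < 2 * k then 1 / (2 * real k) else 0)"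
    using palindromic_unimodular_polynomial[OF assms] by blast
  define \<phi> where "\<phi> j = \<phi>' j / (2 * pi)" for j
  define G where "G \<psi> \<longleftrightarrow> (\<forall>i\<in>{0<..<2 * k}.
    \<bar>coeff (\<Prod>j<k. [:1, - (2 * cos (2 * pi * \<psi> j)), 1:]) i - 1 / (2 * real k)\<bar> < 1 / (4 * real k))" for \<psi>
  have "\<exists>\<epsilon>>0. \<forall>\<psi>. (\<forall>j<k. \<exists>h::int. \<bar>\<psi> j - of_int h - \<phi> j\<bar> < \<epsilon>) \<longrightarrow> G \<psi>"
  proof (rule ccontr)
    assume "\<not> ?thesis"
    hence "\<exists>\<psi>. (\<forall>j<k. \<exists>h::int. \<bar>\<psi> j - of_int h - \<phi> j\<bar> < 1 / real (Suc n)) \<and> \<not> G \<psi>" for n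
      by (metis of_nat_0_less_iff zero_less_Suc zero_less_divide_1_iff)
    then obtain \<psi> where \<psi>: "\<And>n j. j < k \<Longrightarrow> \<exists>h::int. \<bar>\<psi> n j - of_int h - \<phi> j\<bar> < 1 / real (Suc n)"
      "\<And>n. \<not> G (\<psi> n)" by metis
    hence "\<forall>n j. \<exists>h::int. j < k \<longrightarrow> \<bar>\<psi> n j - of_int h - \<phi> j\<bar> < 1 / real (Suc n)" by blast
    then obtain h :: "nat \<Rightarrow> nat \<Rightarrow> int" where
      h: "\<And>n j. j < k \<Longrightarrow> \<bar>\<psi> n j - of_int (h n j) - \<phi> j\<bar> < 1 / real (Suc n)" by metis
    have lim: "(\<lambda>n. 2 * cos (2 * pi * \<psi> n j)) \<longlonglongrightarrow> 2 * cos (2 * pi * \<phi> j)" if "j < k" for j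
    proof -
      have "(\<lambda>n. \<psi> n j - of_int (h n j) - \<phi> j) \<longlonglongrightarrow> 0"
        by (rule Lim_null_comparison[OF _ LIMSEQ_inverse_real_of_nat])
          (use h[OF that] in \<open>auto intro!: always_eventually simp: inverse_eq_divide less_imp_le\<close>)
      hence "(\<lambda>n. \<psi> n j - of_int (h n j)) \<longlonglongrightarrow> \<phi> j" by (simp add: LIM_zero_iff)
      hence "(\<lambda>n. 2 * cos (2 * pi * (\<psi> n j - of_int (h n j)))) \<longlonglongrightarrow> 2 * cos (2 * pi * \<phi> j)"
        by (intro tendsto_intros)
      moreover have "cos (2 * pi * (\<psi> n j - of_int (h n j))) = cos (2 * pi * \<psi> n j)" for n
        by (simp add: right_diff_distrib cos_diff cos_integer_2pi sin_integer_2pi)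
      ultimately show ?thesis by simp
    qed
    have "eventually (\<lambda>n. G (\<psi> n)) sequentially"
      unfolding G_def
    proof (intro eventually_ball_finite ballI)
      fix i assume i: "i \<in> {0<..<2 * k}"
      have "coeff (\<Prod>j<k. [:1, - (2 * cos (2 * pi * \<phi> j)), 1:]) i = 1 / (2 * real k)"
        using i \<phi>'[of i] by (simp add: \<phi>_def)
      moreover have "(\<lambda>n. coeff (\<Prod>j<k. [:1, - (2 * cos (2 * pi * \<psi> n j)), 1:]) i) \<longlonglongrightarrow>
          coeff (\<Prod>j<k. [:1, - (2 * cos (2 * pi * \<phi> j)), 1:]) i"
        using lim by (rule tendsto_coeff_prod_quadratics)
      ultimately have "(\<lambda>n. coeff (\<Prod>j<k. [:1, - (2 * cos (2 * pi * \<psi> n j)), 1:]) i) \<longlonglongrightarrow> 1 / (2 * real k)"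
        by simp
      moreover have "0 < 1 / (4 * real k)" using assms by simp
      ultimately show "eventually (\<lambda>n. \<bar>coeff (\<Prod>j<k. [:1, - (2 * cos (2 * pi * \<psi> n j)), 1:]) i
          - 1 / (2 * real k)\<bar> < 1 / (4 * real k)) sequentially"
        unfolding tendsto_iff dist_real_def by blast
    qed simp
    thus False using \<psi>(2) by simp
  qed
  thus ?thesis unfolding G_def by blast
qed

section \<open>Quasi-greedy expansions of one\<close>

lemma tendsto_fun_componentwise:
  fixes f :: "'a \<Rightarrow> 'i \<Rightarrow> 'b::topological_space"
  shows "(f \<longlongrightarrow> w) F \<longleftrightarrow> (\<forall>i. ((\<lambda>x. f x i) \<longlongrightarrow> w i) F)"
proof -
  have "(f \<longlongrightarrow> w) F \<longleftrightarrow> limitin (product_topology (\<lambda>_. euclidean) UNIV) f w F"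
    by (simp add: euclidean_product_topology limitin_canonical_iff)
  also have "\<dots> \<longleftrightarrow> (\<forall>i. ((\<lambda>x. f x i) \<longlongrightarrow> w i) F)"
    by (simp add: limitin_componentwise)
  finally show ?thesis .
qed

text \<open>Eventually constant letters converge, and letterwise uniqueness of limits makes the
  \<open>THE\<close> in \<open>expansion_one\<close> well defined.\<close>

lemma expansion_one_eqI:
  assumes "\<And>n. eventually (\<lambda>\<epsilon>. beta_digits \<beta> (1 - \<epsilon>) n = w n) (at_right 0)"
  shows "expansion_one \<beta> = w"
proof -
  have lim: "((\<lambda>\<epsilon>. beta_digits \<beta> (1 - \<epsilon>)) \<longlongrightarrow> w) (at_right 0)"
    unfolding tendsto_fun_componentwise using assms by (auto intro: tendsto_eventually)
  show ?thesis unfolding expansion_one_def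
  proof (rule the_equality[where P = "\<lambda>w. ((\<lambda>\<epsilon>. beta_digits \<beta> (1 - \<epsilon>)) \<longlongrightarrow> w) (at_right 0)", OF lim])
    fix v assume "((\<lambda>\<epsilon>. beta_digits \<beta> (1 - \<epsilon>)) \<longlongrightarrow> v) (at_right 0)"
    hence "((\<lambda>\<epsilon>. beta_digits \<beta> (1 - \<epsilon>) n) \<longlongrightarrow> v n) (at_right 0)"
      "((\<lambda>\<epsilon>. beta_digits \<beta> (1 - \<epsilon>) n) \<longlongrightarrow> w n) (at_right 0)" for n
      using lim unfolding tendsto_fun_componentwise by auto
    thus "v = w" by (intro ext tendsto_unique[OF trivial_limit_at_right_real]) 
  qed
qed

text \<open>
  The orbit of \<open>1 - \<epsilon>\<close> is \<open>t n - \<beta> ^ n * \<epsilon>\<close> as long as the error is small; the half-open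
  bounds \<open>0 < t n \<le> 1\<close> are those of the left-continuous version of the beta transformation.
\<close>

lemma expansion_one_of_orbit:
  fixes t :: "nat \<Rightarrow> real" and w :: "nat \<Rightarrow> nat"
  assumes "\<beta> > 1" and t0: "t 0 = 1" and step: "\<And>n. t (Suc n) = \<beta> * t n - real (w n)"
    and bounds: "\<And>n. 0 < t n \<and> t n \<le> 1"
  shows "expansion_one \<beta> = w"
proof (rule expansion_one_eqI)
  have ev: "eventually (\<lambda>\<epsilon>. \<beta> ^ n * \<epsilon> < t n \<and> 0 < \<epsilon>) (at_right 0)" for n
  proof (rule eventually_at_rightI)
    show "0 < t n / \<beta> ^ n" using bounds[of n] \<open>\<beta> > 1\<close> by simp
    fix \<epsilon> assume "\<epsilon> \<in> {0<..<t n / \<beta> ^ n}"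
    thus "\<beta> ^ n * \<epsilon> < t n \<and> 0 < \<epsilon>" using \<open>\<beta> > 1\<close> by (auto simp: field_simps)
  qed
  \<comment> \<open>The remainder \<open>t (Suc n) - \<beta> ^ Suc n * \<epsilon>\<close> is
    positive by the first assumption and below 1 because a positive error is subtracted from a
    number at most 1; hence \<open>w n\<close> is the floor even when
    \<open>t (Suc n) = 1\<close>.\<close>
  have dig: "\<lfloor>\<beta> * (t n - \<beta> ^ n * \<epsilon>)\<rfloor> = int (w n)"
    if "\<beta> ^ Suc n * \<epsilon> < t (Suc n)" "0 < \<epsilon>" for n \<epsilon>
  proof -
    have "\<beta> * (t n - \<beta> ^ n * \<epsilon>) = real (w n) + (t (Suc n) - \<beta> ^ Suc n * \<epsilon>)"
      using step[of n] by (simp add: algebra_simps)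
    moreover have "0 < \<beta> ^ Suc n * \<epsilon>" using that(2) \<open>\<beta> > 1\<close> by simp
    ultimately show ?thesis using bounds[of "Suc n"] that by (intro floor_unique) auto
  qed
  have orbit: "eventually (\<lambda>\<epsilon>. (beta_trans \<beta> ^^ n) (1 - \<epsilon>) = t n - \<beta> ^ n * \<epsilon>) (at_right 0)" for n
  proof (induction n)
    case 0
    show ?case by (simp add: t0)
  next
    case (Suc n)
    show ?case using Suc ev[of "Suc n"]
    proof eventually_elim
      case (elim \<epsilon>)
      hence "(beta_trans \<beta> ^^ Suc n) (1 - \<epsilon>) = \<beta> * (t n - \<beta> ^ n * \<epsilon>) - real (w n)"
        using dig[of n \<epsilon>] by (simp add: beta_trans_def[of \<beta> "t n - \<beta> ^ n * \<epsilon>"])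
      also have "\<dots> = t (Suc n) - \<beta> ^ Suc n * \<epsilon>" using step[of n] by (simp add: algebra_simps)
      finally show ?case .
    qed
  qed
  show "eventually (\<lambda>\<epsilon>. beta_digits \<beta> (1 - \<epsilon>) n = w n) (at_right 0)" for n
    using orbit[of n] ev[of "Suc n"]
    by eventually_elim (simp add: beta_digits_def dig)
qed

text \<open>The hypothesis \<open>eq\<close> says that the candidate orbit \<open>t\<close> of 1
  satisfies \<open>t (p + 1) = t 1\<close>, so \<open>t\<close> inherits the period of
  \<open>w\<close>. Admissibility, in general a lexicographic comparison of shifts, reduces to
  bounding this finite orbit. Since \<open>p\<close> is only some period, the least one is extracted
  at the end.\<close>

lemma mp_periodic_expansion_one:
  fixes w :: "nat \<Rightarrow> nat"
  assumes \<gamma>: "\<gamma> > 1" "real (w 0) \<le> \<gamma>" and p: "p \<ge> 1"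
    and per: "\<And>n. n \<ge> 1 \<Longrightarrow> w (n + p) = w n"
    and dig: "\<And>n. n \<ge> 1 \<Longrightarrow> 1 \<le> w n \<and> w n < w 0"
    and eq: "\<gamma> ^ Suc p = (\<Sum>i\<le>p. real (w i) * \<gamma> ^ (p - i)) + (\<gamma> - real (w 0))"
  shows "\<exists>p'. mp_periodic (expansion_one \<gamma>) 1 p'"
proof -
  define t where "t n = \<gamma> ^ n - (\<Sum>i<n. real (w i) * \<gamma> ^ (n - 1 - i))" for n
  have t0: "t 0 = 1" by (simp add: t_def)
  have step: "t (Suc n) = \<gamma> * t n - real (w n)" for n
  proof -
    have "\<gamma> * (\<Sum>i<n. real (w i) * \<gamma> ^ (n - 1 - i)) = (\<Sum>i<n. real (w i) * \<gamma> ^ (n - i))"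
      unfolding sum_distrib_left
    proof (rule sum.cong[OF refl])
      fix i assume "i \<in> {..<n}"
      hence "n - i = Suc (n - 1 - i)" by simp
      thus "\<gamma> * (real (w i) * \<gamma> ^ (n - 1 - i)) = real (w i) * \<gamma> ^ (n - i)" by simp
    qed
    thus ?thesis by (simp add: t_def algebra_simps)
  qed
  have t1: "t 1 = \<gamma> - real (w 0)" using step[of 0] t0 by simp
  have tp1: "t (Suc p) = t 1"
    unfolding t1 using eq by (simp add: t_def lessThan_Suc_atMost)
  have tper: "t (n + p) = t n" if "n \<ge> 1" for n
    using that
  proof (induction n rule: dec_induct)
    case base
    thus ?case using tp1 by simp
  next
    case (step m)
    thus ?case using \<open>\<And>n. t (Suc n) = \<gamma> * t n - real (w n)\<close>[of "m + p"]
        \<open>\<And>n. t (Suc n) = \<gamma> * t n - real (w n)\<close>[of m] per[of m] by simp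
  qed
  have fin: "t n \<in> t ` {1..p}" if "n \<ge> 1" for n
    using that
  proof (induction n rule: less_induct)
    case (less n)
    show ?case
    proof (cases "n \<le> p")
      case True
      thus ?thesis using less.prems by auto
    next
      case False
      have "t n = t (n - p)" using tper[of "n - p"] False by simp
      thus ?thesis using less.IH[of "n - p"] False p by simp
    qed
  qed
  \<comment> \<open>The orbit is finite, and \<open>t n = (w n + t (n + 1)) / \<gamma>\<close> at an extremal point bounds it.\<close>
  define T where "T = t ` {1..p}"
  have T: "finite T" "T \<noteq> {}" using p by (auto simp: T_def)
  have nxt: "t n = (real (w n) + t (Suc n)) / \<gamma>" for n
    using step[of n] \<gamma> by (simp add: field_simps)
  have "Min T \<in> T" "Max T \<in> T" using T by auto
  then obtain a b where ab: "a \<ge> 1" "t a = Min T" "b \<ge> 1" "t b = Max T" by (auto simp: T_def)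
  have in_T: "Min T \<le> t n" "t n \<le> Max T" if "n \<ge> 1" for n
    using fin[OF that] T by (auto simp: T_def)
  have "Min T * \<gamma> \<ge> Min T"
  proof -
    have "Min T = (real (w a) + t (Suc a)) / \<gamma>" using nxt[of a] ab by simp
    thus ?thesis using in_T(1)[of "Suc a"] \<gamma> by (simp add: field_simps)
  qed
  hence "Min T * (\<gamma> - 1) \<ge> 0" by (simp add: algebra_simps)
  hence mn: "Min T \<ge> 0" using \<gamma> by (simp add: zero_le_mult_iff)
  have mx: "Max T \<le> 1"
  proof -
    have "Max T = (real (w b) + t (Suc b)) / \<gamma>" using nxt[of b] ab by simp
    hence "Max T * \<gamma> \<le> real (w b) + Max T" using in_T(2)[of "Suc b"] \<gamma> by (simp add: field_simps)
    \<comment> \<open>The letters are integers, so lying strictly below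
      \<open>w 0 \<le> \<gamma>\<close> costs at least 1.\<close>
    moreover have "real (w b) \<le> \<gamma> - 1" using dig[OF ab(3)] \<gamma>(2) by linarith
    ultimately have "Max T * (\<gamma> - 1) \<le> 1 * (\<gamma> - 1)" by (simp add: algebra_simps)
    thus ?thesis using \<gamma>(1) by (subst (asm) mult_le_cancel_right) auto
  qed
  \<comment> \<open>The extremal argument only gives nonnegative values; strictness comes from the
    letters being at least 1.\<close>
  have bounds: "0 < t n \<and> t n \<le> 1" for n
  proof (cases "n = 0")
    case True
    thus ?thesis by (simp add: t0)
  next
    case False
    have "0 \<le> t (Suc n)" using in_T(1)[of "Suc n"] mn by simp
    hence "0 < t n" using nxt[of n] dig[of n] False \<gamma> by (simp add: add_pos_nonneg)
    thus ?thesis using in_T(2)[of n] False mx by simp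
  qed
  have w: "expansion_one \<gamma> = w" by (rule expansion_one_of_orbit[OF \<gamma>(1) t0 step bounds])
  have pf: "periodic_from w 1 p" using p per by (auto simp: periodic_from_def)
  define p' where "p' = (LEAST p. periodic_from w 1 p)"
  have "periodic_from w 1 p'" unfolding p'_def using pf by (rule LeastI)
  moreover have "p' \<le> q" if "periodic_from w 1 q" for q
    unfolding p'_def using that by (rule Least_le)
  \<comment> \<open>With preperiod 0 the first letter would recur at position \<open>q\<close>,
    although it exceeds all later letters.\<close>
  moreover have "1 \<le> m" if "periodic_from w m q" for m q
  proof (rule ccontr)
    assume "\<not> 1 \<le> m"
    hence q: "q \<ge> 1" "\<forall>n. w (n + q) = w n" using that by (auto simp: periodic_from_def)
    have "w q = w 0" using q(2)[rule_format, of 0] by simp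
    thus False using dig[OF q(1)] by simp
  qed
  ultimately have "mp_periodic (expansion_one \<gamma>) 1 p'" unfolding w mp_periodic_def by blast
  thus ?thesis ..
qed

section \<open>Return times of torus rotations\<close>

text \<open>\<open>ind\<close> expresses independence over the integers of the
  \<open>\<theta> j\<close> together with 1, which is appended at index \<open>k\<close>.
  Independence in \<open>Kronecker_thm_2\<close> concerns a set of values, so injectivity of the
  family is checked separately, by a relation with coefficients 1 and -1.\<close>

lemma Kronecker_simultaneous:
  fixes \<theta> \<alpha> :: "nat \<Rightarrow> real"
  assumes ind: "\<And>(u :: nat \<Rightarrow> int) v. (\<Sum>j<k. of_int (u j) * \<theta> j) = of_int v \<Longrightarrow> \<forall>j<k. u j = 0"
    and "\<epsilon> > 0"
  shows "\<exists>q::int. \<forall>j<k. \<exists>h::int. \<bar>of_int q * \<theta> j - of_int h - \<alpha> j\<bar> < \<epsilon>"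
proof -
  interpret M: Modules.module "(\<lambda>r. (*) (real_of_int r))"
    by (simp add: Modules.module.intro distrib_left mult.commute)
  define \<theta>' where "\<theta>' = \<theta>(k := 1)"
  have rel0: "u j = 0" if "(\<Sum>i\<le>k. of_int (u i) * \<theta>' i) = 0" "j \<le> k" for u :: "nat \<Rightarrow> int" and j
  proof -
    have *: "(\<Sum>i<k. of_int (u i) * \<theta> i) = of_int (- u k)"
      using that(1) by (simp add: \<theta>'_def flip: lessThan_Suc_atMost)
    hence "\<forall>i<k. u i = 0" by (rule ind)
    moreover from this have "u k = 0" using * by simp
    ultimately show ?thesis using that(2) by (cases "j = k") auto
  qed
  have inj: "inj_on \<theta>' {..k}"
  proof (rule inj_onI, rule ccontr)
    fix a b assume ab: "a \<in> {..k}" "b \<in> {..k}" "\<theta>' a = \<theta>' b" "a \<noteq> b"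
    define u :: "nat \<Rightarrow> int" where "u i = (if i = a then 1 else if i = b then -1 else 0)" for i
    have "(\<Sum>i\<le>k. of_int (u i) * \<theta>' i) = (\<Sum>i\<in>{a, b}. of_int (u i) * \<theta>' i)"
      using ab by (intro sum.mono_neutral_right) (auto simp: u_def)
    also have "\<dots> = 0" using ab by (simp add: u_def)
    finally have "u a = 0" using rel0 ab by blast
    thus False by (simp add: u_def)
  qed
  have "M.independent (\<theta>' ` {..k})"
    unfolding M.independent_explicit_module
  proof (intro allI impI)
    fix t u v assume t: "finite t" "t \<subseteq> \<theta>' ` {..k}" "(\<Sum>v\<in>t. of_int (u v) * v) = 0" "v \<in> t"
    define w where "w i = (if \<theta>' i \<in> t then u (\<theta>' i) else 0)" for i
    have "(\<Sum>i\<le>k. of_int (w i) * \<theta>' i) = (\<Sum>v\<in>\<theta>' ` {..k}. of_int (if v \<in> t then u v else 0) * v)"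
      by (simp add: sum.reindex[OF inj] w_def)
    also have "\<dots> = (\<Sum>v\<in>t. of_int (u v) * v)"
      using t by (intro sum.mono_neutral_cong_right) auto
    finally have "(\<Sum>i\<le>k. of_int (w i) * \<theta>' i) = 0" using t(3) by simp
    moreover obtain j where "j \<le> k" "v = \<theta>' j" using t by auto
    ultimately have "w j = 0" using rel0 by blast
    thus "u v = 0" using t(4) \<open>v = \<theta>' j\<close> by (simp add: w_def)
  qed
  then obtain q h where "\<And>i. i < k \<Longrightarrow> \<bar>of_int q * \<theta>' i - of_int (h i) - \<alpha> i\<bar> < \<epsilon>"
    using Kronecker_thm_2[of \<theta>' k \<epsilon> \<alpha>] inj \<open>\<epsilon> > 0\<close> by (auto simp: \<theta>'_def)
  thus ?thesis by (intro exI[of _ q]) (auto simp: \<theta>'_def)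
qed

text \<open>
  Only Kronecker's theorem is needed, not equidistribution: cut the torus into \<open>L ^ k\<close> cells and choose for
  each cell one multiple of \<open>\<theta>\<close> translating it into the target. This maps \<open>{1..M}\<close>, up to boundary terms,
  at most \<open>L ^ k\<close>-to-one into the set of good times, and \<open>L\<close> does not depend on \<open>\<theta>\<close>.
\<close>

lemma return_frequency:
  fixes \<phi> :: "nat \<Rightarrow> real"
  assumes "\<epsilon> > 0"
  shows "\<exists>c>0. \<forall>\<theta> :: nat \<Rightarrow> real.
    (\<forall>(u :: nat \<Rightarrow> int) v. (\<Sum>j<k. of_int (u j) * \<theta> j) = of_int v \<longrightarrow> (\<forall>j<k. u j = 0)) \<longrightarrow>
    (\<exists>C. \<forall>M. real (card {m \<in> {1..M}. \<forall>j<k. \<exists>h::int. \<bar>real m * \<theta> j - of_int h - \<phi> j\<bar> < \<epsilon>}) \<ge> c * real M - C)"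
proof -
  \<comment> \<open>One \<open>1 / L\<close> is spent on the side of a cell, the other on the error
    in Kronecker's theorem.\<close>
  obtain L where L: "L > 0" "2 / real L < \<epsilon>"
  proof -
    obtain n where "2 / \<epsilon> < real n" using reals_Archimedean2 by blast
    moreover from this have "0 < real n" using assms by (meson divide_pos_pos less_trans zero_less_numeral)
    ultimately show thesis using assms that[of n] by (auto simp: field_simps)
  qed
  define F where "F = ({..<k} \<rightarrow>\<^sub>E {..<L})"
  have F: "finite F" "card F = L ^ k" "F \<noteq> {}"
    using L by (auto simp: F_def card_PiE PiE_eq_empty_iff intro!: finite_PiE)
  have "\<exists>C. \<forall>M. real (card {m \<in> {1..M}. \<forall>j<k. \<exists>h::int. \<bar>real m * \<theta> j - of_int h - \<phi> j\<bar> < \<epsilon>})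
      \<ge> 1 / L ^ k * real M - C"
    if ind: "\<forall>(u :: nat \<Rightarrow> int) v. (\<Sum>j<k. of_int (u j) * \<theta> j) = of_int v \<longrightarrow> (\<forall>j<k. u j = 0)" for \<theta>
  proof -
    define good where "good m \<longleftrightarrow> (\<forall>j<k. \<exists>h::int. \<bar>of_int m * \<theta> j - of_int h - \<phi> j\<bar> < \<epsilon>)" for m :: int
    define G where "G M = {m \<in> {1..M}. good (int m)}" for M :: nat
    \<comment> \<open>The multiple \<open>q\<close> translates the lower corner \<open>f / L\<close>
      of the cell \<open>f\<close> to within \<open>1 / L\<close> of \<open>\<phi>\<close>, modulo
      1.\<close>
    have "\<exists>q::int. \<forall>j<k. \<exists>h::int. \<bar>of_int q * \<theta> j - of_int h - (\<phi> j - real (f j) / L)\<bar> < 1 / L"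
      for f :: "nat \<Rightarrow> nat"
      by (rule Kronecker_simultaneous) (use ind L in auto)
    then obtain q :: "(nat \<Rightarrow> nat) \<Rightarrow> int" where
      q: "\<And>f j. j < k \<Longrightarrow> \<exists>h::int. \<bar>of_int (q f) * \<theta> j - of_int h - (\<phi> j - real (f j) / L)\<bar> < 1 / L"
      by metis
    define cell where "cell m = restrict (\<lambda>j. nat \<lfloor>L * frac (real m * \<theta> j)\<rfloor>) {..<k}" for m :: nat
    have fl: "real (nat \<lfloor>L * frac x\<rfloor>) \<le> L * frac x" "L * frac x < real (nat \<lfloor>L * frac x\<rfloor>) + 1"
      "nat \<lfloor>L * frac x\<rfloor> < L" for x :: real
    proof -
      have "0 \<le> L * frac x" by simp
      thus 1: "real (nat \<lfloor>L * frac x\<rfloor>) \<le> L * frac x" and "L * frac x < real (nat \<lfloor>L * frac x\<rfloor>) + 1"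
        by linarith+
      have "real L * frac x < real L * 1" using L(1) frac_lt_1[of x] by (intro mult_strict_left_mono) auto
      hence "real (nat \<lfloor>L * frac x\<rfloor>) < real L" using 1 by linarith
      thus "nat \<lfloor>L * frac x\<rfloor> < L" by (simp only: of_nat_less_iff)
    qed
    have cellF: "cell m \<in> F" for m
      unfolding F_def cell_def using fl(3) by (intro restrict_PiE_iff[THEN iffD2]) auto
    have shift: "good (int m + q (cell m))" for m
      unfolding good_def
    proof (intro allI impI)
      fix j assume j: "j < k"
      let ?x = "real m * \<theta> j"
      obtain h :: int where h: "\<bar>of_int (q (cell m)) * \<theta> j - of_int h - (\<phi> j - real (cell m j) / L)\<bar> < 1 / L"
        using q[OF j] by blast
      have "real (cell m j) / L \<le> frac ?x" "frac ?x < real (cell m j) / L + 1 / L"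
        using fl(1,2)[of ?x] j L(1) by (auto simp: cell_def field_simps)
      moreover have "?x = frac ?x + of_int \<lfloor>?x\<rfloor>" by (simp add: frac_def)
      ultimately have "\<bar>of_int (int m + q (cell m)) * \<theta> j - of_int (h + \<lfloor>?x\<rfloor>) - \<phi> j\<bar> < 2 / L"
        using h by (simp add: distrib_right)
      thus "\<exists>h::int. \<bar>of_int (int m + q (cell m)) * \<theta> j - of_int h - \<phi> j\<bar> < \<epsilon>"
        using L(2) by (intro exI[of _ "h + \<lfloor>?x\<rfloor>"]) linarith
    qed
    define K where "K = Max ((\<lambda>f. nat \<bar>q f\<bar>) ` F)"
    have K: "\<bar>q f\<bar> \<le> int K" if "f \<in> F" for f
    proof -
      have "nat \<bar>q f\<bar> \<le> K" unfolding K_def using F that by (intro Max_ge) auto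
      thus ?thesis by linarith
    qed
    have main: "real M \<le> real (L ^ k) * real (card (G M)) + 2 * K" for M
    proof -
      \<comment> \<open>Shifts may be negative but are bounded by \<open>K\<close>; trimming both
        ends keeps the shifted times inside \<open>{1..M}\<close>. Truncated subtraction leaves
        \<open>D\<close> empty for small \<open>M\<close>.\<close>
      define D where "D = {K + 1..M - K}"
      have fiber: "card {m \<in> D. cell m = f} \<le> card (G M)" if f: "f \<in> F" for f
      proof (rule card_inj_on_le)
        have pos: "int m + q f \<ge> 1" "int m + q f \<le> int M" if "m \<in> D" for m
          using that K[OF f] by (auto simp: D_def)
        show "inj_on (\<lambda>m. nat (int m + q f)) {m \<in> D. cell m = f}"
          using pos by (intro inj_onI) (auto simp: nat_eq_iff split: if_splits; fastforce)
        show "(\<lambda>m. nat (int m + q f)) ` {m \<in> D. cell m = f} \<subseteq> G M"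
        proof safe
          fix m assume m: "m \<in> D" "f = cell m"
          show "nat (int m + q (cell m)) \<in> G M"
            using pos[OF m(1)] shift[of m] m(2) by (auto simp: G_def nat_le_iff le_nat_iff)
        qed
        show "finite (G M)" by (simp add: G_def)
      qed
      have "D = (\<Union>f\<in>F. {m \<in> D. cell m = f})" using cellF by blast
      hence "card D \<le> (\<Sum>f\<in>F. card {m \<in> D. cell m = f})" using card_UN_le[OF F(1)] by metis
      also have "\<dots> \<le> (\<Sum>f\<in>F. card (G M))" by (intro sum_mono fiber)
      finally have "card D \<le> L ^ k * card (G M)" by (simp add: F(2))
      hence "M - K - K \<le> L ^ k * card (G M)" by (simp add: D_def)
      hence "M \<le> L ^ k * card (G M) + 2 * K" by linarith
      thus ?thesis by (metis of_nat_add of_nat_le_iff of_nat_mult of_nat_numeral)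
    qed
    \<comment> \<open>\<open>K\<close> depends on \<open>\<theta>\<close> but only enters the
      additive constant; the slope \<open>1 / L ^ k\<close> does not.\<close>
    have "1 / L ^ k * real M - 2 * K / L ^ k \<le> real (card (G M))" for M
      using main[of M] L(1) by (simp add: field_simps)
    thus ?thesis unfolding G_def good_def by (intro exI[of _ "2 * K / L ^ k"]) simp
  qed
  moreover have "(1 / real (L ^ k)) > 0" using L by simp
  ultimately show ?thesis by (intro exI[of _ "1 / real (L ^ k)"]) auto
qed

section \<open>Powers of Salem numbers\<close>

lemma poly_of_int_poly_of_real:
  "poly (map_poly of_int p) (complex_of_real x) = of_real (poly (map_poly of_int p) x)"
  by (simp add: poly_altdef coeff_map_poly)

lemma poly_of_int_poly_cnj:
  "poly (map_poly of_int p) (cnj z) = cnj (poly (map_poly of_int p) z)"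
  by (simp add: poly_altdef coeff_map_poly)

lemma common_root_transfer:
  fixes p q :: "int poly" and a b :: complex
  assumes "irreducible p" "degree p > 0" "poly (map_poly of_int p) a = 0" "poly (map_poly of_int q) a = 0"
    and "poly (map_poly of_int p) b = 0"
  shows "poly (map_poly of_int q) b = 0"
proof -
  obtain u where "q = p * u" using int_poly_dvd_if_common_root[OF assms(1-4)] by (elim dvdE)
  thus ?thesis using assms(5) by (simp add: of_int_poly_hom.hom_mult)
qed

text \<open>A multiple root would be shared with \<open>pderiv p\<close>, a nonzero polynomial of
  smaller degree that \<open>p\<close> would then divide.\<close>

lemma card_roots_irreducible_int_poly:
  fixes p :: "int poly"
  assumes p: "irreducible p" "degree p > 0"
  shows "card {z :: complex. poly (map_poly of_int p) z = 0} = degree p"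
proof -
  let ?P = "map_poly of_int p :: complex poly"
  have p0: "?P \<noteq> 0" using p by (auto simp: map_poly_eq_0_iff)
  have "rsquarefree ?P" unfolding rsquarefree_roots
  proof (intro allI notI, elim conjE)
    fix a assume a: "poly ?P a = 0" "poly (pderiv ?P) a = 0"
    hence "p dvd pderiv p"
      using p by (intro int_poly_dvd_if_common_root[of p a]) (auto simp: of_int_hom.map_poly_pderiv)
    moreover have "pderiv p \<noteq> 0" using p(2) by (simp add: pderiv_eq_0_iff)
    ultimately have "degree p \<le> degree (pderiv p)" by (rule dvd_imp_degree_le)
    thus False using p(2) by (simp add: degree_pderiv)
  qed
  thus ?thesis using rsquarefree_card_degree[OF p0] by simp
qed

text \<open>At a conjugate on the unit circle the inverse is the complex conjugate, so the reversed
  polynomial shares a root with \<open>p\<close> and vanishes at all conjugates. Closure under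
  inverses then forces every conjugate other than \<open>\<beta>\<close> and
  \<open>1 / \<beta>\<close> onto the circle; none of these is real, so they pair up.\<close>

lemma salem_roots:
  assumes "salem_number \<beta> d" "d \<ge> 4" "even d"
  shows "\<exists>p A. lead_coeff p = (1::int) \<and> irreducible p \<and> degree p = d \<and> finite A \<and> d = 2 * card A + 2
    \<and> (\<forall>z\<in>A. Im z > 0 \<and> cmod z = 1)
    \<and> {z. poly (map_poly of_int p) z = 0} = {of_real \<beta>, of_real (1 / \<beta>)} \<union> (A \<union> cnj ` A)"
proof -
  obtain p z0 where \<beta>: "\<beta> > 1" and p: "lead_coeff p = (1::int)" "irreducible p" "degree p = d"
    and p\<beta>: "poly (map_poly of_int p) \<beta> = (0::real)"
    and le1: "\<And>z::complex. poly (map_poly of_int p) z = 0 \<Longrightarrow> z \<noteq> of_real \<beta> \<Longrightarrow> cmod z \<le> 1"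
    and z0: "poly (map_poly of_int p) z0 = 0" "cmod z0 = 1"
    using assms(1) unfolding salem_number_def by blast
  define Z where "Z = {z::complex. poly (map_poly of_int p) z = 0}"
  define A where "A = {z\<in>Z. Im z > 0}"
  have dp: "degree p > 0" using p assms(2) by simp
  have \<beta>Z: "of_real \<beta> \<in> Z" using p\<beta> by (simp add: Z_def poly_of_int_poly_of_real)
  have finZ: "finite Z" "card Z = d"
    using card_roots_irreducible_int_poly[OF p(2) dp] p(3) assms(2) card.infinite[of Z] by (fastforce simp: Z_def)+
  have transfer: "poly (map_poly of_int q) b = 0"
    if "a \<in> Z" "poly (map_poly of_int q) a = 0" "b \<in> Z" for q :: "int poly" and a b
    using common_root_transfer[OF p(2) dp _ that(2)] that by (simp add: Z_def)
  have cnjZ: "cnj z \<in> Z" if "z \<in> Z" for z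
    using that by (simp add: Z_def poly_of_int_poly_cnj)
  \<comment> \<open>Transfer of the linear polynomial with root \<open>c\<close> would force
    \<open>\<beta>\<close> to equal \<open>c\<close>.\<close>
  have not_int: "of_int c \<notin> Z" if "c \<in> {-1, 0, 1}" for c
  proof
    assume c: "of_int c \<in> Z"
    have "poly (map_poly of_int [:- c, 1:]) (complex_of_real \<beta>) = 0"
      by (rule transfer[OF c _ \<beta>Z]) simp
    hence "complex_of_real \<beta> = of_int c" by simp
    hence "complex_of_real \<beta> = of_real (of_int c)" by simp
    hence "\<beta> = of_int c" by (simp only: of_real_eq_iff)
    thus False using that \<beta> by auto
  qed
  have invZ: "inverse z \<in> Z" if z: "z \<in> Z" for z
  proof -
    have nz: "z \<noteq> 0" using not_int[of 0] z by auto
    have r: "map_poly of_int (reflect_poly p) = reflect_poly (map_poly of_int p :: complex poly)"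
      by (rule poly_eqI) (auto simp: coeff_map_poly coeff_reflect_poly)
    have "z0 * cnj z0 = 1" using complex_norm_square[of z0] z0(2) by simp
    hence "z0 \<noteq> 0" "inverse z0 = cnj z0" by (auto intro: inverse_unique)
    hence "poly (map_poly of_int (reflect_poly p)) z0 = 0"
      using z0 unfolding r by (simp add: poly_reflect_poly_nz poly_of_int_poly_cnj)
    hence "poly (map_poly of_int (reflect_poly p)) z = 0"
      by (intro transfer[of z0 _ z] z) (use z0 in \<open>simp_all add: Z_def\<close>)
    thus ?thesis unfolding r using nz by (simp add: poly_reflect_poly_nz Z_def)
  qed
  have norm1: "cmod z = 1" if "z \<in> Z" "z \<noteq> of_real \<beta>" "z \<noteq> of_real (1 / \<beta>)" for z
  proof (rule antisym)
    show "cmod z \<le> 1" using le1 that by (simp add: Z_def)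
    have "inverse z \<noteq> of_real \<beta>"
      using that(3) by (metis inverse_eq_divide inverse_inverse_eq of_real_inverse)
    hence "cmod (inverse z) \<le> 1" using le1 invZ[OF that(1)] by (simp add: Z_def)
    moreover have "z \<noteq> 0" using not_int[of 0] that(1) by auto
    ultimately show "1 \<le> cmod z" by (simp add: norm_inverse norm_divide field_simps)
  qed
  have nonreal: "Im z \<noteq> 0" if "z \<in> Z" "z \<noteq> of_real \<beta>" "z \<noteq> of_real (1 / \<beta>)" for z
  proof
    assume "Im z = 0"
    hence z: "z = of_real (Re z)" by (simp add: complex_eq_iff)
    hence "\<bar>Re z\<bar> = 1" using norm1[OF that] by (metis norm_of_real)
    hence "z = of_int 1 \<or> z = of_int (-1)" using z by (auto simp: abs_if split: if_splits)
    thus False using that(1) not_int[of 1] not_int[of "-1"] by auto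
  qed
  have A: "finite A" "\<forall>z\<in>A. Im z > 0" using finZ by (auto simp: A_def)
  have Z: "Z = {of_real \<beta>, of_real (1 / \<beta>)} \<union> (A \<union> cnj ` A)"
  proof (intro equalityI subsetI)
    fix z assume z: "z \<in> Z"
    show "z \<in> {of_real \<beta>, of_real (1 / \<beta>)} \<union> (A \<union> cnj ` A)"
    proof (cases "z \<in> {of_real \<beta>, of_real (1 / \<beta>)}")
      case False
      hence "Im z \<noteq> 0" using nonreal z by blast
      hence "z \<in> A \<or> cnj z \<in> A" using z cnjZ by (auto simp: A_def)
      moreover have "z = cnj (cnj z)" by simp
      ultimately show ?thesis by blast
    qed blast
  next
    fix z assume "z \<in> {of_real \<beta>, of_real (1 / \<beta>)} \<union> (A \<union> cnj ` A)"
    moreover have "complex_of_real (1 / \<beta>) \<in> Z" using invZ[OF \<beta>Z] by (simp add: inverse_eq_divide)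
    ultimately show "z \<in> Z" using \<beta>Z cnjZ by (auto simp: A_def)
  qed
  have "{complex_of_real \<beta>, of_real (1 / \<beta>)} \<inter> (A \<union> cnj ` A) = {}"
    using A(2) by (auto simp: complex_eq_iff)
  moreover have "card {complex_of_real \<beta>, of_real (1 / \<beta>)} = 2"
  proof -
    have "1 / \<beta> < \<beta>" using \<beta> by (smt (verit) divide_less_eq_1)
    hence "complex_of_real \<beta> \<noteq> of_real (1 / \<beta>)" unfolding of_real_eq_iff by simp
    thus ?thesis by (rule card_2_iff[THEN iffD2, OF exI, OF exI, OF conjI[OF refl]])
  qed
  ultimately have "card Z = 2 + 2 * card A"
    unfolding Z using A by (subst card_Un_disjoint) (auto simp: card_Un_cnj)
  moreover have "cmod z = 1" if "z \<in> A" for z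
    using that by (intro norm1) (auto simp: A_def)
  ultimately show ?thesis using p A finZ Z unfolding Z_def
    by (intro exI[of _ p] exI[of _ A]) auto
qed

text \<open>
  Writing \<open>q = x ^ d - a\<^sub>1 * x ^ (d - 1) - \<dots> - a\<^sub>1 * x + 1\<close> with \<open>d = 2 * k + 2\<close>, the equation
  \<open>q(\<gamma>) = 0\<close> says that the word
  \<open>a\<^sub>1 (a\<^sub>2 \<dots> a\<^sub>d\<^sub>-\<^sub>2 (a\<^sub>1 - 1) (a\<^sub>1 - 1))\<^sup>\<infinity>\<close> has value 1 in base \<open>\<gamma>\<close>. The condition on the middle coefficients of \<open>R\<close>
  makes all letters after the first one lie strictly between \<open>0\<close> and \<open>a\<^sub>1\<close>, so that the word is admissible.
\<close>

lemma mp_periodic_of_salem_shape: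
  fixes q :: "int poly" and R :: "real poly" and \<gamma> :: real
  assumes k: "k \<ge> 1" and \<gamma>: "\<gamma> \<ge> 16 * real k"
    and q: "map_poly of_int q = [:1, - (\<gamma> + 1 / \<gamma>), 1:] * R"
    and R: "coeff R 0 = 1" "coeff R (2 * k) = 1" "degree R = 2 * k" "coeff R (2 * k - 1) = coeff R 1"
    and mid: "\<forall>i\<in>{0<..<2 * k}. \<bar>coeff R i - 1 / (2 * real k)\<bar> < 1 / (4 * real k)"
  shows "\<exists>p. mp_periodic (expansion_one \<gamma>) 1 p"
proof -
  define s where "s = \<gamma> + 1 / \<gamma>"
  define c where "c i = coeff q i" for i
  have g16: "\<gamma> \<ge> 16" using \<gamma> k by (smt (verit) of_nat_1 of_nat_mono mult_le_cancel_left_pos)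
  have s: "s > \<gamma>" using g16 by (simp add: s_def)
  note s = s order_trans[OF g16 less_imp_le[OF s]]
  have R0: "coeff R i = 0" if "i > 2 * k" for i using that R(3) by (simp add: coeff_eq_0)
  have Rmid: "1 / (4 * real k) < coeff R i" "coeff R i < 3 / (4 * real k)" if "0 < i" "i < 2 * k" for i
  proof -
    have "\<bar>coeff R i - 1 / (2 * real k)\<bar> < 1 / (4 * real k)" using mid that by simp
    moreover have "1 / (2 * real k) = 2 * (1 / (4 * real k))" "3 / (4 * real k) = 3 * (1 / (4 * real k))"
      using k by simp_all
    ultimately show "1 / (4 * real k) < coeff R i" "coeff R i < 3 / (4 * real k)" by linarith+
  qed
  have k34: "3 / (4 * real k) \<le> 3 / 4" using k by (simp add: field_simps)
  have R01: "0 \<le> coeff R i" "coeff R i \<le> 1" for i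
  proof -
    consider "i = 0" | "0 < i" "i < 2 * k" | "i = 2 * k" | "i > 2 * k" by linarith
    hence "0 \<le> coeff R i \<and> coeff R i \<le> 1"
    proof cases
      case 2
      have "0 \<le> 1 / (4 * real k)" by simp
      thus ?thesis using Rmid[OF 2] k34 by linarith
    qed (use R R0 in auto)
    thus "0 \<le> coeff R i" "coeff R i \<le> 1" by auto
  qed
  have cq: "real_of_int (c (Suc (Suc i))) = coeff R (Suc (Suc i)) - s * coeff R (Suc i) + coeff R i"
    "real_of_int (c (Suc 0)) = coeff R (Suc 0) - s" "real_of_int (c 0) = 1" for i
  proof -
    have e: "real_of_int (c i) = coeff ([:1, - s, 1:] * R) i" for i
      using arg_cong[OF q, of "\<lambda>f. coeff f i"] by (simp add: c_def coeff_map_poly s_def)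
    show "real_of_int (c (Suc (Suc i))) = coeff R (Suc (Suc i)) - s * coeff R (Suc i) + coeff R i"
      "real_of_int (c (Suc 0)) = coeff R (Suc 0) - s" "real_of_int (c 0) = 1"
      unfolding e using R(1) by (simp_all add: coeff_pCons)
  qed
  have c0: "c 0 = 1" using cq(3) by simp
  have c1: "c 1 = c (2 * k + 1)"
  proof -
    obtain k' where k': "2 * k = Suc (Suc k')" using k by (cases k) auto
    have "real_of_int (c (2 * k + 1)) = real_of_int (c 1)"
      using cq(1)[of "Suc k'"] cq(2) R R0[of "Suc (2 * k)"] by (simp add: k')
    thus ?thesis by simp
  qed
  have cd: "c (2 * k + 2) = 1"
    using cq(1)[of "2 * k"] R(2) R0[of "Suc (2 * k)"] R0[of "Suc (Suc (2 * k))"] by simp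
  define a where "a i = nat (- c i)" for i
  have a1: "real (a 1) = - real_of_int (c 1)" "real (a 1) = s - coeff R 1"
  proof -
    have "real_of_int (c 1) \<le> 0" using cq(2) R01(2)[of 1] s by simp
    thus "real (a 1) = - real_of_int (c 1)" by (simp add: a_def)
    thus "real (a 1) = s - coeff R 1" using cq(2) by simp
  qed
  have amid: "real (a i) = - real_of_int (c i) \<and> 1 \<le> a i \<and> a i < a 1" if i: "2 \<le> i" "i \<le> 2 * k" for i
  proof -
    obtain l where l: "i = Suc (Suc l)" using i by (metis add_2_eq_Suc le_Suc_ex)
    have m: "1 / (4 * real k) < coeff R (Suc l)" "coeff R (Suc l) < 3 / (4 * real k)" using Rmid[of "Suc l"] l i by auto
    \<comment> \<open>Here the constant 16 is spent: \<open>s\<close> times the coefficient is at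
      least 4, so the letter is at least 2 after subtracting two neighbouring coefficients. It is at
      most \<open>3 / 4 * s\<close>, hence below \<open>a 1 \<ge> s - 1\<close> because
      \<open>s \<ge> 16\<close>.\<close>
    have "s * coeff R (Suc l) \<ge> (16 * real k) * (1 / (4 * real k))"
      using m s \<gamma> k by (intro mult_mono) auto
    also have "(16 * real k) * (1 / (4 * real k)) = 4" using k by simp
    finally have low: "s * coeff R (Suc l) \<ge> 4" .
    have up: "s * coeff R (Suc l) \<le> s * (3 / 4)" using m k34 s by (intro mult_left_mono) auto
    have ci: "- real_of_int (c i) \<ge> 2" "- real_of_int (c i) \<le> s * (3 / 4)"
      unfolding l cq(1) using low up R01(1,2)[of l] R01(1,2)[of "Suc (Suc l)"] by linarith+
    hence ai: "real (a i) = - real_of_int (c i)" by (simp add: a_def)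
    moreover have "1 \<le> real (a i)" using ai ci by linarith
    moreover have "real (a i) < real (a 1)" using ai ci a1(2) R01(2)[of 1] s by linarith
    ultimately show ?thesis by simp
  qed
  have a1big: "a 1 \<ge> 2"
  proof -
    have "real (a 1) \<ge> 2" using a1(2) R01(2)[of 1] s by linarith
    thus ?thesis by linarith
  qed
  have a1le: "real (a 1) \<le> \<gamma>"
  proof -
    \<comment> \<open>Since \<open>a 1 = \<gamma> + 1 / \<gamma> - coeff R 1\<close>, the claim
      amounts to \<open>1 / \<gamma> \<le> coeff R 1\<close>.\<close>
    have "1 / (16 * real k) \<ge> 1 / \<gamma>" using \<gamma> k by (intro divide_left_mono) auto
    moreover have "1 / (16 * real k) \<le> 1 / (4 * real k)" using k by (simp add: field_simps)
    moreover have "1 / (4 * real k) < coeff R 1" using Rmid[of 1] k by simp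
    ultimately show ?thesis using a1(2) by (simp add: s_def)
  qed
  \<comment> \<open>The two letters \<open>a 1 - 1\<close> close the orbit: \<open>(a 1 - 1) *
    \<gamma> + (a 1 - 1) + (\<gamma> - a 1) = a 1 * \<gamma> - 1\<close>, the lowest two terms of
    the root equation. Indices are shifted by one, since words start at 0.\<close>
  define v where "v i = (if i < 2 * k then a (Suc i) else a 1 - 1)" for i
  define w where "w n = (if n = 0 then v 0 else v (Suc ((n - 1) mod (2 * k + 1))))" for n
  have wv: "w i = v i" if "i \<le> 2 * k + 1" for i
    using that by (cases i) (auto simp: w_def)
  have w0: "w 0 = a 1" using k by (simp add: w_def v_def)
  have v: "1 \<le> v i \<and> v i < a 1" if "i \<ge> 1" for i
    using amid[of "Suc i"] that a1big by (auto simp: v_def)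
  show ?thesis
  proof (rule mp_periodic_expansion_one[where w = w and p = "2 * k + 1"])
    show "\<gamma> > 1" using g16 by simp
    show "real (w 0) \<le> \<gamma>" using w0 a1le by simp
    show "w (n + (2 * k + 1)) = w n" if "n \<ge> 1" for n
    proof -
      have "n + (2 * k + 1) - 1 = (n - 1) + (2 * k + 1)" using that by simp
      hence "(n + (2 * k + 1) - 1) mod (2 * k + 1) = (n - 1) mod (2 * k + 1)" by (simp only: mod_add_self2)
      thus ?thesis using that unfolding w_def by simp
    qed
    show "1 \<le> w n \<and> w n < w 0" if "n \<ge> 1" for n
      using that v[of "Suc ((n - 1) mod (2 * k + 1))"] unfolding w0 by (simp add: w_def)
    have qdeg: "degree q \<le> 2 * k + 2"
    proof (rule degree_le, intro allI impI)
      fix i assume "i > 2 * k + 2"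
      then obtain l where l: "i = Suc (Suc l)" "l > 2 * k" by (metis add_2_eq_Suc' less_imp_Suc_add add_less_cancel_right Suc_lessE Suc_less_SucD)
      hence "real_of_int (c i) = 0" using cq(1)[of l] R0 by simp
      thus "coeff q i = 0" by (simp add: c_def)
    qed
    have "\<gamma> \<noteq> 0" using g16 by simp
    \<comment> \<open>Evaluating at the other root of the quadratic factor and clearing denominators
      reverses the powers, so each \<open>c i\<close> meets
      \<open>\<gamma> ^ (2 * k + 2 - i)\<close>; palindromicity enters only through
      \<open>c 1 = c (2 * k + 1)\<close> and the end coefficients.\<close>
    hence "poly (map_poly of_int q) (1 / \<gamma>) = 0" unfolding q by (simp add: field_simps)
    moreover have "poly (map_poly of_int q) (1 / \<gamma>) = (\<Sum>i\<le>2 * k + 2. real_of_int (c i) * (1 / \<gamma>) ^ i)"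
      unfolding poly_altdef using qdeg
      by (intro sum.mono_neutral_cong_left) (auto simp: coeff_map_poly c_def coeff_eq_0 degree_map_poly)
    ultimately have "0 = \<gamma> ^ (2 * k + 2) * (\<Sum>i\<le>2 * k + 2. real_of_int (c i) * (1 / \<gamma>) ^ i)" by simp
    also have "\<dots> = (\<Sum>i\<le>2 * k + 2. real_of_int (c i) * \<gamma> ^ (2 * k + 2 - i))"
      unfolding sum_distrib_left
    proof (rule sum.cong[OF refl])
      fix i assume "i \<in> {..2 * k + 2}"
      hence "\<gamma> ^ (2 * k + 2) = \<gamma> ^ (2 * k + 2 - i) * \<gamma> ^ i" by (simp flip: power_add)
      thus "\<gamma> ^ (2 * k + 2) * (real_of_int (c i) * (1 / \<gamma>) ^ i) = real_of_int (c i) * \<gamma> ^ (2 * k + 2 - i)"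
        using \<open>\<gamma> \<noteq> 0\<close> by (simp add: power_one_over)
    qed
    also have "\<dots> = \<gamma> ^ (2 * k + 2) + (\<Sum>i\<le>2 * k. real_of_int (c (Suc i)) * \<gamma> ^ (2 * k + 1 - i)) + 1"
    proof -
      have ends: "(\<Sum>i\<le>N + 2. f i) = f 0 + (\<Sum>i\<le>N. f (Suc i)) + f (N + 2)" for N and f :: "nat \<Rightarrow> real"
        using sum.atMost_Suc[of f "Suc N"] sum.atMost_Suc_shift[of f N] by simp
      show ?thesis unfolding ends using c0 cd by simp
    qed
    finally have root: "\<gamma> ^ (2 * k + 2) = (\<Sum>i\<le>2 * k. - real_of_int (c (Suc i)) * \<gamma> ^ (2 * k + 1 - i)) - 1"
      by (simp add: sum_negf)
    have "(\<Sum>i\<le>2 * k + 1. real (w i) * \<gamma> ^ (2 * k + 1 - i))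
        = (\<Sum>i\<le>2 * k. real (v i) * \<gamma> ^ (2 * k + 1 - i)) + real (v (2 * k + 1))"
      by (simp add: wv)
    also have "(\<Sum>i\<le>2 * k. real (v i) * \<gamma> ^ (2 * k + 1 - i))
        = (\<Sum>i<2 * k. real (v i) * \<gamma> ^ (2 * k + 1 - i)) + (real (a 1) - 1) * \<gamma>"
      using a1big by (simp add: v_def flip: lessThan_Suc_atMost)
    also have "(\<Sum>i<2 * k. real (v i) * \<gamma> ^ (2 * k + 1 - i))
        = (\<Sum>i<2 * k. - real_of_int (c (Suc i)) * \<gamma> ^ (2 * k + 1 - i))"
    proof (rule sum.cong[OF refl])
      fix i assume i: "i \<in> {..<2 * k}"
      have "real (a (Suc i)) = - real_of_int (c (Suc i))"
        using amid[of "Suc i"] a1(1) i by (cases i) auto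
      thus "real (v i) * \<gamma> ^ (2 * k + 1 - i) = - real_of_int (c (Suc i)) * \<gamma> ^ (2 * k + 1 - i)"
        using i by (simp add: v_def)
    qed
    also have "real (v (2 * k + 1)) = real (a 1) - 1" using a1big by (simp add: v_def)
    finally have "(\<Sum>i\<le>2 * k + 1. real (w i) * \<gamma> ^ (2 * k + 1 - i)) =
      (\<Sum>i\<le>2 * k. - real_of_int (c (Suc i)) * \<gamma> ^ (2 * k + 1 - i)) - \<gamma> + (real (a 1) - 1)"
      using a1(1) c1 by (simp add: algebra_simps flip: lessThan_Suc_atMost)
    thus "\<gamma> ^ Suc (2 * k + 1) = (\<Sum>i\<le>2 * k + 1. real (w i) * \<gamma> ^ (2 * k + 1 - i)) + (\<gamma> - real (w 0))"
      using root w0 by simp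
  qed simp
qed

text \<open>
  Apply the conjugation sending \<open>a i\<close> to \<open>\<beta>\<close> to the relation \<open>\<Prod>j<k. a j powi u j = 1\<close>: all other factors
  stay on the unit circle, so comparing moduli gives \<open>\<beta> powi u i = 1\<close>.
\<close>

lemma salem_angles_independent:
  fixes p :: "int poly" and u :: "nat \<Rightarrow> int"
  assumes p: "irreducible p" "degree p > 0" and \<beta>: "\<beta> > 1"
    and A: "\<forall>z\<in>A. Im z > 0 \<and> cmod z = 1"
    and Z: "{z. poly (map_poly of_int p) z = 0} = {of_real \<beta>, of_real (1 / \<beta>)} \<union> (A \<union> cnj ` A)"
    and a: "bij_betw a {..<k} A"
    and rel: "(\<Sum>j<k. of_int (u j) * (Arg (a j) / (2 * pi))) = of_int v" and i: "i < k"
  shows "u i = 0"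
proof -
  let ?Z = "{z::complex. poly (map_poly of_int p) z = 0}"
  have aA: "a j \<in> A" if "j < k" for j using a that by (auto simp: bij_betw_def)
  have aZ: "a j \<in> ?Z" if "j < k" for j using aA[OF that] unfolding Z by blast
  have ca: "cis (Arg (a j)) = a j" if "j < k" for j
    using aA[OF that] A by (subst cis_Arg) (auto simp: sgn_div_norm)
  have "(\<Prod>j<k. a j powi u j) = (\<Prod>j<k. cis (of_int (u j) * Arg (a j)))"
    by (rule prod.cong[OF refl]) (metis ca cis_power_int lessThan_iff)
  also have "\<dots> = cis (\<Sum>j<k. of_int (u j) * Arg (a j))"
    by (induction k) (auto simp: cis_mult)
  also have "(\<Sum>j<k. of_int (u j) * Arg (a j)) = 2 * pi * of_int v"
    unfolding rel[symmetric] by (simp add: sum_distrib_left)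
  also have "cis (2 * pi * of_int v) = 1" by (simp add: complex_eq_iff cos_integer_2pi sin_integer_2pi)
  finally have prod1: "(\<Prod>j<k. a j powi u j) = 1" .
  have "poly (map_poly of_int p) (a i) = 0" "poly (map_poly of_int p) (complex_of_real \<beta>) = 0"
    using aZ[OF i] Z by auto
  from conjugation_hom[OF p this] obtain L \<sigma> where
    L: "is_subfield L" "field_hom_on L \<sigma>" "?Z \<subseteq> L" "\<sigma> (a i) = complex_of_real \<beta>"
      "\<forall>z. poly (map_poly of_int p) z = 0 \<longrightarrow> poly (map_poly of_int p) (\<sigma> z) = 0" by auto
  have norm1: "cmod (\<sigma> (a j)) = 1" if j: "j < k" "j \<noteq> i" for j
  proof -
    have "a j \<noteq> a i" using a i j by (auto simp: bij_betw_def inj_on_def)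
    hence "\<sigma> (a j) \<noteq> of_real \<beta>" using field_hom_on_inj[OF L(1,2), of "a j" "a i"] L(3,4) aZ i j by auto
    \<comment> \<open>Only \<open>inverse (a i)\<close> is sent to \<open>1 / \<beta>\<close>. It
      equals \<open>cnj (a i)\<close>, in the lower half plane, while \<open>A\<close> lies in the
      upper one.\<close>
    moreover have "\<sigma> (a j) \<noteq> of_real (1 / \<beta>)"
    proof
      assume e: "\<sigma> (a j) = of_real (1 / \<beta>)"
      have iL: "a i \<in> L" "a j \<in> L" using aZ i j L(3) by auto
      have "\<sigma> (inverse (a i)) = of_real (1 / \<beta>)"
        using field_hom_onD(6)[OF L(1,2) iL(1)] L(4) by (simp add: inverse_eq_divide)
      hence "a j = inverse (a i)"
        using field_hom_on_inj[OF L(1,2) iL(2) subfield_closed(7)[OF L(1) iL(1)]] e by simp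
      moreover have "a i * cnj (a i) = 1" using complex_norm_square[of "a i"] aA[OF i] A by simp
      ultimately have "a j = cnj (a i)" by (simp add: inverse_unique)
      hence "Im (a j) = - Im (a i)" by simp
      moreover have "Im (a i) > 0" "Im (a j) > 0" using A aA[OF i] aA[OF j(1)] by blast+
      ultimately show False by simp
    qed
    moreover have "\<sigma> (a j) \<in> ?Z" using L(5) aZ[OF j(1)] by blast
    ultimately have "\<sigma> (a j) \<in> A \<union> cnj ` A" unfolding Z by blast
    thus ?thesis using A by auto
  qed
  have "\<sigma> (\<Prod>j<k. a j powi u j) = (\<Prod>j<k. \<sigma> (a j) powi u j)"
  proof -
    have aL: "a j \<in> L" if "j \<in> {..<k}" for j using aZ that L(3) by auto
    have "\<sigma> (\<Prod>j<k. a j powi u j) = (\<Prod>j<k. \<sigma> (a j powi u j))"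
      by (rule field_hom_on_prod[OF L(1,2)]) (rule subfield_power_int[OF L(1) aL])
    also have "\<dots> = (\<Prod>j<k. \<sigma> (a j) powi u j)"
      by (rule prod.cong[OF refl]) (rule field_hom_on_power_int[OF L(1,2) aL])
    finally show ?thesis .
  qed
  hence "1 = (\<Prod>j<k. cmod (\<sigma> (a j)) powi u j)"
    using prod1 field_hom_onD(1)[OF L(1,2)] by (metis (no_types, lifting) norm_one norm_power_int prod.cong prod_norm)
  also have "\<dots> = (\<Prod>j<k. if j = i then \<beta> powi u i else 1)"
    using norm1 L(4) \<beta> by (intro prod.cong) auto
  also have "\<dots> = \<beta> powi u i" using i by simp
  finally have "\<beta> powi u i = 1" by simp
  thus "u i = 0"
    using \<beta> power_int_strict_increasing[of 0 "u i" \<beta>] power_int_strict_increasing[of "u i" 0 \<beta>] by fastforce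
qed

text \<open>The \<open>m\<close>-th powers stay distinct: if \<open>z ^ m = w ^ m\<close>, moving
  \<open>z\<close> to \<open>\<beta>\<close> sends \<open>w\<close> to a conjugate of modulus
  \<open>\<beta>\<close>, and there is only one. The product over all conjugates then splits into
  the real pair and the pairs from \<open>A\<close>.\<close>

lemma salem_power_polynomial:
  fixes p :: "int poly"
  assumes p: "lead_coeff p = 1" "irreducible p" "degree p > 0" and \<beta>: "\<beta> > 1"
    and A: "finite A" "\<forall>z\<in>A. Im z > 0 \<and> cmod z = 1"
    and Z: "{z. poly (map_poly of_int p) z = 0} = {of_real \<beta>, of_real (1 / \<beta>)} \<union> (A \<union> cnj ` A)"
    and a: "bij_betw a {..<k} A" and m: "m \<ge> 1"
  shows "\<exists>q :: int poly. map_poly of_int q = [:1, - (\<beta> ^ m + 1 / \<beta> ^ m), 1:] *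
    (\<Prod>j<k. [:1, - (2 * cos (2 * pi * (real m * (Arg (a j) / (2 * pi))))), 1:])"
proof -
  let ?Z = "{z::complex. poly (map_poly of_int p) z = 0}"
  have le\<beta>: "cmod z < \<beta>" if "z \<in> ?Z" "z \<noteq> of_real \<beta>" for z
  proof -
    have "1 / \<beta> < 1" using \<beta> by simp
    hence "1 / \<beta> < \<beta>" using \<beta> by linarith
    moreover have "z = of_real (1 / \<beta>) \<or> cmod z = 1" using that A(2) unfolding Z by auto
    moreover have "cmod (of_real (1 / \<beta>)) = 1 / \<beta>" using \<beta> by (simp only: norm_of_real) simp
    ultimately show ?thesis using \<beta> by fastforce
  qed
  have inj: "inj_on (\<lambda>z. z ^ m) ?Z"
  proof (rule inj_onI)
    fix z w assume zw: "z \<in> ?Z" "w \<in> ?Z" "z ^ m = w ^ m"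
    have "poly (map_poly of_int p) z = 0" "poly (map_poly of_int p) (complex_of_real \<beta>) = 0"
      using zw Z by auto
    from conjugation_hom[OF p(2,3) this] obtain L \<sigma> where
      L: "is_subfield L" "field_hom_on L \<sigma>" "?Z \<subseteq> L" "\<sigma> z = complex_of_real \<beta>"
        "\<forall>z. poly (map_poly of_int p) z = 0 \<longrightarrow> poly (map_poly of_int p) (\<sigma> z) = 0" by auto
    have zwL: "z \<in> L" "w \<in> L" using zw L(3) by auto
    have "\<sigma> w ^ m = of_real \<beta> ^ m"
      using field_hom_on_power[OF L(1,2) zwL(1), of m] field_hom_on_power[OF L(1,2) zwL(2), of m]
      by (simp add: zw(3) L(4))
    hence "cmod (\<sigma> w ^ m) = cmod (of_real \<beta> ^ m)" by simp
    hence "cmod (\<sigma> w) ^ m = \<beta> ^ m" using \<beta> by (simp add: norm_power)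
    hence "cmod (\<sigma> w) = \<beta>" using m \<beta> by (auto dest: power_eq_imp_eq_base[of _ m])
    hence "\<sigma> w = of_real \<beta>" using le\<beta>[of "\<sigma> w"] L(5) zw(2) by auto
    thus "z = w" using field_hom_on_inj[OF L(1,2) zwL] L(4) by simp
  qed
  have "card ?Z = degree p" by (rule card_roots_irreducible_int_poly[OF p(2,3)])
  then obtain q :: "int poly" where q: "map_poly of_int q = (\<Prod>z\<in>?Z. [:- (z ^ m), 1:])"
    using int_poly_of_power_roots[OF p(1) refl _ inj _ p(3)] by auto
  have "(\<Prod>z\<in>?Z. [:- (z ^ m), 1:]) =
      (\<Prod>z\<in>{of_real \<beta>, of_real (1 / \<beta>)}. [:- (z ^ m), 1:]) * (\<Prod>z\<in>A \<union> cnj ` A. [:- (z ^ m), 1:])"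
    unfolding Z using A by (intro prod.union_disjoint) (auto simp: complex_eq_iff)
  also have "(\<Prod>z\<in>{of_real \<beta>, of_real (1 / \<beta>)}. [:- (z ^ m), 1:]) =
      map_poly complex_of_real [:1, - (\<beta> ^ m + 1 / \<beta> ^ m), 1:]"
  proof -
    have "1 / \<beta> < \<beta>" using \<beta> by (smt (verit) divide_less_eq_1)
    hence "complex_of_real \<beta> \<noteq> of_real (1 / \<beta>)" unfolding of_real_eq_iff by simp
    thus ?thesis using \<beta> by (simp add: Polynomial.map_poly_pCons power_one_over)
  qed
  also have "(\<Prod>z\<in>A \<union> cnj ` A. [:- (z ^ m), 1:]) = (\<Prod>z\<in>A. [:- (z ^ m), 1:] * [:- (cnj z ^ m), 1:])"
    using A by (intro prod_Un_cnj) auto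
  also have "\<dots> = (\<Prod>j<k. [:- (a j ^ m), 1:] * [:- (cnj (a j) ^ m), 1:])"
    by (rule prod.reindex_bij_betw[OF a, symmetric])
  also have "\<dots> = (\<Prod>j<k. map_poly complex_of_real [:1, - (2 * cos (2 * pi * (real m * (Arg (a j) / (2 * pi))))), 1:])"
  proof (rule prod.cong[OF refl])
    fix j assume "j \<in> {..<k}"
    hence "a j \<in> A" using a by (auto simp: bij_betw_def)
    hence "a j = cis (Arg (a j))" using A by (subst cis_Arg) (auto simp: sgn_div_norm)
    hence "a j ^ m = cis (real m * Arg (a j))" by (metis Complex.DeMoivre)
    moreover from this have "cnj (a j) ^ m = cnj (cis (real m * Arg (a j)))" by (metis complex_cnj_power)
    ultimately show "[:- (a j ^ m), 1:] * [:- (cnj (a j) ^ m), 1:] =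
        map_poly complex_of_real [:1, - (2 * cos (2 * pi * (real m * (Arg (a j) / (2 * pi))))), 1:]"
      by (simp only: cis_pair_quadratic) simp
  qed
  also have "map_poly complex_of_real [:1, - (\<beta> ^ m + 1 / \<beta> ^ m), 1:] * \<dots> = map_poly complex_of_real
      ([:1, - (\<beta> ^ m + 1 / \<beta> ^ m), 1:] * (\<Prod>j<k. [:1, - (2 * cos (2 * pi * (real m * (Arg (a j) / (2 * pi))))), 1:]))"
    by (simp only: map_poly_of_real_mult map_poly_of_real_prod)
  finally have e: "map_poly of_int q = map_poly complex_of_real
      ([:1, - (\<beta> ^ m + 1 / \<beta> ^ m), 1:] * (\<Prod>j<k. [:1, - (2 * cos (2 * pi * (real m * (Arg (a j) / (2 * pi))))), 1:]))"
    (is "_ = map_poly complex_of_real ?R") using q by simp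
  have "of_int (coeff q i) = coeff ?R i" for i
  proof -
    have "complex_of_real (of_int (coeff q i)) = complex_of_real (coeff ?R i)"
      using arg_cong[OF e, of "\<lambda>f. coeff f i"] by (simp only: coeff_map_poly of_int_0 of_real_0 of_real_of_int_eq)
    thus ?thesis by (simp only: of_real_eq_iff)
  qed
  hence "map_poly of_int q = ?R" by (intro poly_eqI) (simp only: coeff_map_poly of_int_0)
  thus ?thesis by blast
qed

section \<open>Assembling the density bound\<close>

lemma palindromic_prod_quadratics:
  fixes c :: "nat \<Rightarrow> real" and k :: nat
  defines "R \<equiv> \<Prod>j<k. [:1, - c j, 1:]"
  shows "degree R = 2 * k" "coeff R 0 = 1" "coeff R (2 * k) = 1" "i \<le> 2 * k \<Longrightarrow> coeff R (2 * k - i) = coeff R i"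
proof -
  show d: "degree R = 2 * k" unfolding R_def by (subst degree_prod_sum_eq) auto
  have "reflect_poly [:1, - x, 1:] = [:1, - x, 1:]" for x :: real
    by (simp add: reflect_poly_def)
  hence refl: "reflect_poly R = R" unfolding R_def by (simp add: reflect_poly_prod)
  show sym: "i \<le> 2 * k \<Longrightarrow> coeff R (2 * k - i) = coeff R i" for i
    using coeff_reflect_poly[of R i] by (simp add: refl d)
  show "coeff R 0 = 1" by (simp add: R_def poly_prod flip: poly_0_coeff_0)
  thus "coeff R (2 * k) = 1" using sym[of 0] by simp
qed

text \<open>Giving up half of \<open>c\<close> absorbs the additive constant as soon as
  \<open>M\<close> exceeds \<open>2 * C / c\<close>.\<close>

lemma positive_lower_density:
  fixes W :: "nat set"
  assumes c: "c > 0" and count: "\<And>M. real (card (W \<inter> {1..M})) \<ge> c * real M - C"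
  shows "ereal (c / 2) \<le> liminf (\<lambda>M. ereal (real (card (W \<inter> {1..M})) / real M))" and "infinite W"
proof -
  have "eventually (\<lambda>M. ereal (c / 2) \<le> ereal (real (card (W \<inter> {1..M})) / real M)) sequentially"
  proof -
    obtain M0 where M0: "2 * C / c < real M0" using reals_Archimedean2 by blast
    have "ereal (c / 2) \<le> ereal (real (card (W \<inter> {1..M})) / real M)" if "M \<ge> max 1 M0" for M
    proof -
      have "2 * C / c < real M" using M0 that by (meson less_le_trans max.boundedE of_nat_le_iff)
      hence "C \<le> c / 2 * real M" using c by (simp add: field_simps)
      hence "c / 2 * real M \<le> real (card (W \<inter> {1..M}))" using count[of M] by simp
      thus ?thesis using that by (simp add: field_simps)
    qed
    thus ?thesis unfolding eventually_sequentially by blast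
  qed
  thus "ereal (c / 2) \<le> liminf (\<lambda>M. ereal (real (card (W \<inter> {1..M})) / real M))"
    by (rule Liminf_bounded)
  show "infinite W"
  proof
    assume fin: "finite W"
    obtain M where "(real (card W) + C) / c < real M" using reals_Archimedean2 by blast
    hence "real (card W) < c * real M - C" using c by (simp add: field_simps)
    also have "\<dots> \<le> real (card (W \<inter> {1..M}))" using count[of M] by simp
    also have "\<dots> \<le> real (card W)" using fin by (simp add: card_mono)
    finally show False by simp
  qed
qed

text \<open>The slope \<open>c\<close> is supplied from outside, while \<open>C\<close> may depend
  on \<open>\<beta>\<close>: it collects the boundary error of the rotation and the exponents up to
  \<open>N\<close>, for which \<open>\<beta> ^ m\<close> may be below \<open>16 * k\<close>.\<close>

lemma salem_powers_frequency:
  fixes \<phi> :: "nat \<Rightarrow> real"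
  assumes salem: "salem_number \<beta> d" and d: "d \<ge> 4" "even d" and k: "k \<ge> 1" "d = 2 * k + 2"
    and nb: "\<forall>\<psi>. (\<forall>j<k. \<exists>h::int. \<bar>\<psi> j - of_int h - \<phi> j\<bar> < \<epsilon>) \<longrightarrow> (\<forall>i\<in>{0<..<2 * k}.
      \<bar>coeff (\<Prod>j<k. [:1, - (2 * cos (2 * pi * \<psi> j)), 1:]) i - 1 / (2 * real k)\<bar> < 1 / (4 * real k))"
    and freq: "\<forall>\<theta> :: nat \<Rightarrow> real.
      (\<forall>(u :: nat \<Rightarrow> int) v. (\<Sum>j<k. of_int (u j) * \<theta> j) = of_int v \<longrightarrow> (\<forall>j<k. u j = 0)) \<longrightarrow>
      (\<exists>C. \<forall>M. real (card {m \<in> {1..M}. \<forall>j<k. \<exists>h::int. \<bar>real m * \<theta> j - of_int h - \<phi> j\<bar> < \<epsilon>}) \<ge> c * real M - C)"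
  shows "\<exists>C. \<forall>M. real (card ({m. m > 0 \<and> (\<exists>p. mp_periodic (expansion_one (\<beta> ^ m)) 1 p)} \<inter> {1..M})) \<ge> c * real M - C"
proof -
  have \<beta>: "\<beta> > 1" using salem by (simp add: salem_number_def)
  obtain p A where p: "lead_coeff p = (1::int)" "irreducible p" "degree p = d"
    and A: "finite A" "d = 2 * card A + 2" "\<forall>z\<in>A. Im z > 0 \<and> cmod z = 1"
    and Z: "{z. poly (map_poly of_int p) z = 0} = {of_real \<beta>, of_real (1 / \<beta>)} \<union> (A \<union> cnj ` A)"
    using salem_roots[OF salem d] by (elim exE conjE)
  have dp: "degree p > 0" using p(3) d(1) by simp
  have "card A = k" using A(2) k(2) by simp
  then obtain a where a: "bij_betw a {..<k} A"
    using ex_bij_betw_nat_finite[OF A(1)] by (auto simp: atLeast0LessThan)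
  define \<theta> where "\<theta> j = Arg (a j) / (2 * pi)" for j
  have ind: "\<forall>(u :: nat \<Rightarrow> int) v. (\<Sum>j<k. of_int (u j) * \<theta> j) = of_int v \<longrightarrow> (\<forall>j<k. u j = 0)"
    unfolding \<theta>_def
    by (intro allI impI) (rule salem_angles_independent[OF p(2) dp \<beta> A(3) Z a])
  obtain C where C: "\<And>M. real (card {m \<in> {1..M}. \<forall>j<k. \<exists>h::int. \<bar>real m * \<theta> j - of_int h - \<phi> j\<bar> < \<epsilon>}) \<ge> c * real M - C"
    using freq[THEN spec, THEN mp, OF ind] by blast
  obtain N where N: "16 * real k \<le> \<beta> ^ N"
    using real_arch_pow[OF \<beta>, of "16 * real k"] less_imp_le by blast
  define W where "W = {m::nat. m > 0 \<and> (\<exists>p. mp_periodic (expansion_one (\<beta> ^ m)) 1 p)}"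
  have good: "m \<in> W" if "m > N" and m: "\<forall>j<k. \<exists>h::int. \<bar>real m * \<theta> j - of_int h - \<phi> j\<bar> < \<epsilon>" for m
  proof -
    let ?R = "\<Prod>j<k. [:1, - (2 * cos (2 * pi * (real m * \<theta> j))), 1:]"
    have "m \<ge> 1" using that(1) by simp
    from salem_power_polynomial[OF p(1,2) dp \<beta> A(1,3) Z a this]
    obtain q :: "int poly" where q: "map_poly of_int q = [:1, - (\<beta> ^ m + 1 / \<beta> ^ m), 1:] * ?R"
      unfolding \<theta>_def by (elim exE)
    have "\<beta> ^ N \<le> \<beta> ^ m" using \<beta> that(1) by (intro power_increasing) auto
    hence "16 * real k \<le> \<beta> ^ m" using N by linarith
    moreover note R = palindromic_prod_quadratics[where k = k and c = "\<lambda>j. 2 * cos (2 * pi * (real m * \<theta> j))"]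
    have "coeff ?R (2 * k - 1) = coeff ?R 1" using k(1) by (intro R(4)) simp
    ultimately have "\<exists>p. mp_periodic (expansion_one (\<beta> ^ m)) 1 p"
      by (rule mp_periodic_of_salem_shape[OF k(1) _ q R(2,3,1) _ nb[THEN spec, THEN mp, OF m]])
    thus ?thesis using that(1) by (simp add: W_def)
  qed
  have count: "real (card (W \<inter> {1..M})) \<ge> c * real M - (C + real N)" for M
  proof -
    let ?G = "{m \<in> {1..M}. \<forall>j<k. \<exists>h::int. \<bar>real m * \<theta> j - of_int h - \<phi> j\<bar> < \<epsilon>}"
    have "?G \<subseteq> (W \<inter> {1..M}) \<union> {1..N}"
    proof
      fix m assume "m \<in> ?G"
      hence m: "m \<in> {1..M}" "\<forall>j<k. \<exists>h::int. \<bar>real m * \<theta> j - of_int h - \<phi> j\<bar> < \<epsilon>"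
        unfolding mem_Collect_eq by (rule conjunct1, rule conjunct2)
      show "m \<in> (W \<inter> {1..M}) \<union> {1..N}"
      proof (cases "m > N")
        case True
        thus ?thesis using good[OF True m(2)] m(1) by simp
      next
        case False
        thus ?thesis using m(1) by simp
      qed
    qed
    hence "card ?G \<le> card ((W \<inter> {1..M}) \<union> {1..N})" by (intro card_mono) auto
    also have "\<dots> \<le> card (W \<inter> {1..M}) + card {1..N}" by (rule card_Un_le)
    finally have "real (card ?G) \<le> real (card (W \<inter> {1..M})) + real N" by simp
    thus ?thesis using C[of M] by linarith
  qed
  thus ?thesis unfolding W_def by blast
qed

theorem theorem1:
  fixes d :: nat
  assumes "even d" and "d \<ge> 4"
  shows "\<exists>c::real. c > 0 \<and>
    (\<forall>\<beta>::real. salem_number \<beta> d \<longrightarrow>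
       liminf (\<lambda>M::nat. ereal (real (card {m \<in> {1..M}. \<exists>p. mp_periodic (expansion_one (\<beta> ^ m)) 1 p}) / real M))
         \<ge> ereal c
       \<and> infinite {m::nat. m > 0 \<and> parry_number (\<beta> ^ m)})"
proof -
  define k where "k = (d - 2) div 2"
  have k: "k \<ge> 1" "d = 2 * k + 2" using assms by (auto simp: k_def)
  obtain \<phi> :: "nat \<Rightarrow> real" and \<epsilon> where \<epsilon>: "\<epsilon> > 0"
    and nb: "\<forall>\<psi>. (\<forall>j<k. \<exists>h::int. \<bar>\<psi> j - of_int h - \<phi> j\<bar> < \<epsilon>) \<longrightarrow> (\<forall>i\<in>{0<..<2 * k}.
      \<bar>coeff (\<Prod>j<k. [:1, - (2 * cos (2 * pi * \<psi> j)), 1:]) i - 1 / (2 * real k)\<bar> < 1 / (4 * real k))"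
    using unimodular_neighbourhood[OF k(1)] by (elim exE conjE)
  \<comment> \<open>\<open>\<phi>\<close>, \<open>\<epsilon>\<close> and \<open>c\<close> are fixed
    before \<open>\<beta>\<close> is introduced, which makes the bound uniform over all Salem
    numbers of degree \<open>d\<close>.\<close>
  obtain c where c: "c > 0" and freq: "\<forall>\<theta> :: nat \<Rightarrow> real.
    (\<forall>(u :: nat \<Rightarrow> int) v. (\<Sum>j<k. of_int (u j) * \<theta> j) = of_int v \<longrightarrow> (\<forall>j<k. u j = 0)) \<longrightarrow>
    (\<exists>C. \<forall>M. real (card {m \<in> {1..M}. \<forall>j<k. \<exists>h::int. \<bar>real m * \<theta> j - of_int h - \<phi> j\<bar> < \<epsilon>}) \<ge> c * real M - C)"
    using return_frequency[OF \<epsilon>, of k \<phi>] by (elim exE conjE)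
  show ?thesis
  proof (intro exI[of _ "c / 2"] conjI allI impI)
    show "c / 2 > 0" using c by simp
  next
    fix \<beta> assume salem: "salem_number \<beta> d"
    define W where "W = {m::nat. m > 0 \<and> (\<exists>p. mp_periodic (expansion_one (\<beta> ^ m)) 1 p)}"
    have "\<exists>C. \<forall>M. real (card (W \<inter> {1..M})) \<ge> c * real M - C"
      unfolding W_def by (rule salem_powers_frequency[OF salem assms(2,1) k nb freq])
    then obtain C where C: "\<And>M. real (card (W \<inter> {1..M})) \<ge> c * real M - C" by blast
    have "{m \<in> {1..M}. \<exists>p. mp_periodic (expansion_one (\<beta> ^ m)) 1 p} = W \<inter> {1..M}" for M
      by (auto simp: W_def)
    thus "ereal (c / 2) \<le> liminf (\<lambda>M::nat. ereal (real (card {m \<in> {1..M}. \<exists>p. mp_periodic (expansion_one (\<beta> ^ m)) 1 p}) / real M))"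
      using positive_lower_density(1)[OF c C] by simp
    have parry: "W \<subseteq> {m::nat. m > 0 \<and> parry_number (\<beta> ^ m)}"
    proof
      fix m assume "m \<in> W"
      then obtain p where "m > 0" and mp: "mp_periodic (expansion_one (\<beta> ^ m)) 1 p"
        unfolding W_def mem_Collect_eq by (elim conjE exE)
      have "periodic_from (expansion_one (\<beta> ^ m)) 1 p"
        using mp unfolding mp_periodic_def by (rule conjunct1)
      hence "parry_number (\<beta> ^ m)"
        unfolding parry_number_def eventually_periodic_def by (intro exI)
      with \<open>m > 0\<close> show "m \<in> {m. m > 0 \<and> parry_number (\<beta> ^ m)}"
        unfolding mem_Collect_eq by (rule conjI)
    qed
    thus "infinite {m::nat. m > 0 \<and> parry_number (\<beta> ^ m)}"
      using positive_lower_density(2)[OF c C] by (rule infinite_super)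
  qed
qed

end
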